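(* Let $\Omega\subset\mathbb{C}$ be a bounded open set with connected components $\Omega_i$, $1\le i\le N$ ($N\in\mathbb{Z}_+\cup\{\infty\}$), and let $\alpha=(\alpha_i)_{i=1}^N$ be a sequence of positive integers. An operator $T$ in the generalized Cowen–Douglas class $\mathfrak{B}_\alpha(\Omega)$ is reducible if and only if $E_T$ is reducible.
   Context: $T$ is reducible if it has a closed subspace $\mathcal{M}$, other than $\{0\}$ and the whole space, with $T\mathcal{M}\subset\mathcal{M}$ and $T^*\mathcal{M}\subset\mathcal{M}$. Generalized Cowen–Douglas class: $\mathfrak{B}_\alpha(\Omega)$ is the set of bounded operators $T$ on a separable complex Hilbert space $\mathcal{H}$ such that (1) $\mathrm{Ran}(T-w)=\mathcal{H}$ for $w\in\Omega$; (2) $\bigvee_{w\in\Omega}\mathrm{Ker}(T-w)=\mathcal{H}$ (closed linear span); (3) $\dim\mathrm{Ker}(T-w)=\alpha_i$ for all $w\in\Omega_i$ and all $i$. Kernel bundle: for $T\in\mathfrak{B}_\alpha(\Omega)$, $E_T(\Omega_i)=\{(w,x)\in\Omega_i\times\mathcal{H}:x\in\mathrm{Ker}(T-w)\}$ is a Hermitian holomorphic vector bundle over $\Omega_i$ of rank $\alpha_i$, and $E_T=\bigsqcup_{i=1}^N E_T(\Omega_i)$ (disjoint union). $E_T$ is reducible if there exist $E^1=\bigsqcup_i E^1(\Omega_i)$ and $E^2=\bigsqcup_i E^2(\Omega_i)$, where $E^1(\Omega_i),E^2(\Omega_i)$ are (possibly zero) holomorphic subbundles of $E_T(\Omega_i)$,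 with $E^1,E^2$ each different from $\{0\}$ and $E_T$, such that (1) $E^1(\Omega_i)\oplus E^2(\Omega_i)=E_T(\Omega_i)$ for all $i$; (2) $E^1(\Omega_i)\perp E^2(\Omega_j)$ for all $i,j$, i.e. $\bigvee_{w\in\Omega_i}E^1(w)\perp\bigvee_{w\in\Omega_j}E^2(w)$. *)

theory Defs
  imports "HOL-Analysis.Analysis" "HOL-Library.Extended_Nat" "HOL-Library.Set_Algebras"
begin

subsection \<open>Complex Hilbert spaces\<close>

text \<open>
  The inner product is linear in the first and conjugate-linear in the second argument.
  The axiom \<open>cinner_self\<close> says that the norm (hence metric and topology, inherited from
  the real normed structure) is the one induced by the inner product; positive definiteness
  of the inner product is a consequence of it.  \<open>scaleC_of_real\<close> makes the real normed
  structure the restriction of scalars of the complex one.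
\<close>

class complex_inner_space = real_normed_vector +
  fixes scaleC :: "complex \<Rightarrow> 'a \<Rightarrow> 'a"  (infixr "*\<^sub>C" 75)
    and cinner :: "'a \<Rightarrow> 'a \<Rightarrow> complex"
  assumes scaleC_of_real: "complex_of_real r *\<^sub>C x = r *\<^sub>R x"
    and scaleC_add_right: "a *\<^sub>C (x + y) = a *\<^sub>C x + a *\<^sub>C y"
    and scaleC_add_left: "(a + b) *\<^sub>C x = a *\<^sub>C x + b *\<^sub>C x"
    and scaleC_scaleC: "a *\<^sub>C b *\<^sub>C x = (a * b) *\<^sub>C x"
    and cinner_commute: "cinner x y = cnj (cinner y x)"
    and cinner_add_left: "cinner (x + y) z = cinner x z + cinner y z"
    and cinner_scaleC_left: "cinner (a *\<^sub>C x) y = a * cinner x y"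
    and cinner_self: "cinner x x = complex_of_real ((norm x)\<^sup>2)"

class complex_hilbert_space = complex_inner_space + complete_space

instantiation complex :: complex_hilbert_space
begin

definition scaleC_complex :: "complex \<Rightarrow> complex \<Rightarrow> complex"
  where "scaleC_complex a x = a * x"

definition cinner_complex :: "complex \<Rightarrow> complex \<Rightarrow> complex"
  where "cinner_complex x y = x * cnj y"

instance
  by standard
    (simp_all add: scaleC_complex_def cinner_complex_def scaleR_conv_of_real
      algebra_simps complex_norm_square del: of_real_power)

end

text \<open>
  Algebraic complex-linear notions.  As everywhere in the library, \<open>cdim V\<close> is \<open>0\<close> when
  \<open>V\<close> is infinite-dimensional, so \<open>cdim V = n\<close> with \<open>n > 0\<close> entails finite dimension.
\<close>

lemma vector_space_scaleC:
  "vector_space (scaleC :: complex \<Rightarrow> 'a \<Rightarrow> 'a::complex_inner_space)"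
proof
  show "1 *\<^sub>C x = x" for x :: 'a
    using scaleC_of_real[of 1 x] by simp
qed (simp_all add: scaleC_add_right scaleC_add_left scaleC_scaleC)

global_interpretation complex_vector:
  vector_space "scaleC :: complex \<Rightarrow> 'a \<Rightarrow> 'a::complex_inner_space"
  defines csubspace = complex_vector.subspace
    and cspan = complex_vector.span
    and cdependent = complex_vector.dependent
    and cdim = complex_vector.dim
  by (rule vector_space_scaleC)

text \<open>The closed linear span, written with a big join in the literature.\<close>

definition closed_cspan :: "'a::complex_inner_space set \<Rightarrow> 'a set"
  where "closed_cspan S = closure (cspan S)"

subsection \<open>Operators\<close>

definition bounded_clinear ::
    "('a::complex_inner_space \<Rightarrow> 'b::complex_inner_space) \<Rightarrow> bool"
  where "bounded_clinear T \<longleftrightarrow> bounded_linear T \<and> (\<forall>c x. T (c *\<^sub>C x) = c *\<^sub>C T x)"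

text \<open>
  Same format as the library's \<open>adjoint\<close> for real inner product spaces.  For a bounded
  operator on a Hilbert space the chosen function exists (Riesz) and is unique.
\<close>

definition cadjoint ::
    "('a::complex_inner_space \<Rightarrow> 'b::complex_inner_space) \<Rightarrow> 'b \<Rightarrow> 'a"
  where "cadjoint T = (SOME S. \<forall>x y. cinner (T x) y = cinner x (S y))"

definition reducible_operator :: "('a::complex_hilbert_space \<Rightarrow> 'a) \<Rightarrow> bool"
  where "reducible_operator T \<longleftrightarrow>
    (\<exists>M. csubspace M \<and> closed M \<and> M \<noteq> {0} \<and> M \<noteq> UNIV \<and>
         T ` M \<subseteq> M \<and> cadjoint T ` M \<subseteq> M)"

definition eigenspace :: "('a::complex_inner_space \<Rightarrow> 'a) \<Rightarrow> complex \<Rightarrow> 'a set"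
  where "eigenspace T w = {x. T x - w *\<^sub>C x = 0}"

subsection \<open>The generalized Cowen--Douglas class\<close>

text \<open>Index set of a sequence \<open>1 \<le> i \<le> N\<close>, where \<open>N\<close> may be infinite.\<close>

definition indices :: "enat \<Rightarrow> nat set"
  where "indices N = {i. 1 \<le> i \<and> enat i \<le> N}"

text \<open>
  \<open>C i\<close>, for \<open>i \<in> indices N\<close>, is the enumeration of the connected components of \<open>\<Omega>\<close>
  with respect to which the dimensions \<open>\<alpha> i\<close> are prescribed.
\<close>

definition generalized_Cowen_Douglas ::
    "complex set \<Rightarrow> enat \<Rightarrow> (nat \<Rightarrow> complex set) \<Rightarrow> (nat \<Rightarrow> nat)
      \<Rightarrow> ('a::complex_hilbert_space \<Rightarrow> 'a) set"
  where "generalized_Cowen_Douglas \<Omega> N C \<alpha> =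
    {T. bounded_clinear T \<and>
        (\<forall>w\<in>\<Omega>. range (\<lambda>x. T x - w *\<^sub>C x) = UNIV) \<and>
        closed_cspan (\<Union>w\<in>\<Omega>. eigenspace T w) = UNIV \<and>
        (\<forall>i\<in>indices N. \<forall>w\<in>C i. cdim (eigenspace T w) = \<alpha> i)}"

subsection \<open>Bundles\<close>

text \<open>
  All bundles occurring here are subsets of a trivial bundle \<open>U \<times> H\<close>; the Hermitian and
  the holomorphic structure are the ones induced from it, so that holomorphic sections are
  holomorphic \<open>H\<close>-valued functions with values in the fibres.
\<close>

definition fibre :: "(complex \<times> 'a) set \<Rightarrow> complex \<Rightarrow> 'a set"
  where "fibre E w = {x. (w, x) \<in> E}"

definition holomorphic_map_on ::
    "(complex \<Rightarrow> 'a::complex_inner_space) \<Rightarrow> complex set \<Rightarrow> bool"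
  where "holomorphic_map_on s V \<longleftrightarrow>
    (\<forall>w\<in>V. \<exists>D. (s has_derivative (\<lambda>h. h *\<^sub>C D)) (at w within V))"

definition holomorphic_section_on ::
    "(complex \<times> 'a::complex_inner_space) set \<Rightarrow> (complex \<Rightarrow> 'a) \<Rightarrow> complex set \<Rightarrow> bool"
  where "holomorphic_section_on E s V \<longleftrightarrow>
    holomorphic_map_on s V \<and> (\<forall>w\<in>V. s w \<in> fibre E w)"

text \<open>
  \<open>F\<close> is a holomorphic subbundle, of some constant rank \<open>k\<close>, of the bundle \<open>E\<close> over \<open>U\<close>:
  around every point there are \<open>k\<close> holomorphic sections of \<open>E\<close> that form a basis of
  every nearby fibre of \<open>F\<close>.  The case \<open>k = 0\<close> is the zero bundle.
\<close>

definition holomorphic_subbundle ::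
    "complex set \<Rightarrow> (complex \<times> 'a::complex_inner_space) set \<Rightarrow> (complex \<times> 'a) set \<Rightarrow> bool"
  where "holomorphic_subbundle U F E \<longleftrightarrow>
    F \<subseteq> E \<and> F \<subseteq> U \<times> UNIV \<and>
    (\<exists>k::nat. \<forall>w0\<in>U. \<exists>V s. open V \<and> w0 \<in> V \<and> V \<subseteq> U \<and>
       (\<forall>j<k. holomorphic_section_on E (s j) V) \<and>
       (\<forall>w\<in>V. inj_on (\<lambda>j. s j w) {..<k} \<and>
               \<not> cdependent ((\<lambda>j. s j w) ` {..<k}) \<and>
               cspan ((\<lambda>j. s j w) ` {..<k}) = fibre F w))"

text \<open>The part of the kernel bundle of \<open>T\<close> lying over \<open>U\<close>.\<close>

definition kernel_bundle ::
    "('a::complex_inner_space \<Rightarrow> 'a) \<Rightarrow> complex set \<Rightarrow> (complex \<times> 'a) set"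
  where "kernel_bundle T U = {(w, x). w \<in> U \<and> x \<in> eigenspace T w}"

text \<open>
  A bundle over the disjoint union of the \<open>C i\<close> is the disjoint union
  \<open>SIGMA i : indices N. E i\<close> of a family of bundles \<open>E i\<close> over \<open>C i\<close>;
  with this encoding \<open>SIGMA i : indices N. C i \<times> {0}\<close> is the zero bundle.
\<close>

definition kernel_bundle_union ::
    "('a::complex_inner_space \<Rightarrow> 'a) \<Rightarrow> enat \<Rightarrow> (nat \<Rightarrow> complex set) \<Rightarrow> (nat \<times> complex \<times> 'a) set"
  where "kernel_bundle_union T N C = (SIGMA i : indices N. kernel_bundle T (C i))"

definition reducible_kernel_bundle ::
    "('a::complex_hilbert_space \<Rightarrow> 'a) \<Rightarrow> enat \<Rightarrow> (nat \<Rightarrow> complex set) \<Rightarrow> bool"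
  where "reducible_kernel_bundle T N C \<longleftrightarrow>
    (\<exists>E1 E2 :: nat \<Rightarrow> (complex \<times> 'a) set.
       (\<forall>i\<in>indices N. holomorphic_subbundle (C i) (E1 i) (kernel_bundle T (C i))) \<and>
       (\<forall>i\<in>indices N. holomorphic_subbundle (C i) (E2 i) (kernel_bundle T (C i))) \<and>
       Sigma (indices N) E1 \<noteq> (SIGMA i : indices N. C i \<times> {0}) \<and>
       Sigma (indices N) E1 \<noteq> kernel_bundle_union T N C \<and>
       Sigma (indices N) E2 \<noteq> (SIGMA i : indices N. C i \<times> {0}) \<and>
       Sigma (indices N) E2 \<noteq> kernel_bundle_union T N C \<and>
       (\<forall>i\<in>indices N. \<forall>w\<in>C i.
          fibre (E1 i) w + fibre (E2 i) w = fibre (kernel_bundle T (C i)) w \<and>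
          fibre (E1 i) w \<inter> fibre (E2 i) w = {0}) \<and>
       (\<forall>i\<in>indices N. \<forall>j\<in>indices N.
          \<forall>x\<in>closed_cspan (\<Union>w\<in>C i. fibre (E1 i) w).
          \<forall>y\<in>closed_cspan (\<Union>w\<in>C j. fibre (E2 j) w). cinner x y = 0))"

end

theory Submission
  imports Defs
begin

text \<open>
  A reducing subspace \<open>M\<close> splits every eigenspace as the orthogonal sum of its intersections with
  \<open>M\<close> and with the orthogonal complement of \<open>M\<close>, and the point is that these intersections form
  holomorphic bundles.  By the open mapping theorem \<open>T - w0\<close> has norm-controlled preimages inside
  \<open>M\<close>, so an eigenvector \<open>x 0\<close> in \<open>M\<close> extends to a sequence with \<open>(T - w0) x (n + 1) = x n\<close>, and
  \<open>\<Sum>n. (w - w0)^n x n\<close> is a holomorphic section of eigenvectors in \<open>M\<close>.  Extending orthonormal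
  bases in this way shows that both intersections have lower semicontinuous dimension.  The
  dimensions add up to a constant, so both are locally constant and the sections are frames.
  Conversely, the closed spans of two orthogonal complementary subbundles are invariant under \<open>T\<close>
  and, because the eigenvectors span a dense subspace, orthogonal complements of each other.
\<close>

instance complex_hilbert_space \<subseteq> banach ..

subsection \<open>Complex inner products\<close>

lemma cinner_add_right:
  "cinner x (y + z) = cinner x y + cinner (x::'a::complex_inner_space) z"
  by (metis cinner_add_left cinner_commute complex_cnj_add)

lemma cinner_scaleC_right:
  "cinner x (a *\<^sub>C y) = cnj a * cinner (x::'a::complex_inner_space) y"
  by (metis cinner_scaleC_left cinner_commute complex_cnj_mult)

lemma scaleC_one [simp]: "1 *\<^sub>C x = (x::'a::complex_inner_space)"
  using scaleC_of_real[of 1 x] by simp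

lemma scaleC_minus_one [simp]: "(- 1) *\<^sub>C x = - (x::'a::complex_inner_space)"
  using scaleC_of_real[of "- 1" x] by simp

lemma cinner_minus_left [simp]: "cinner (- x) y = - cinner (x::'a::complex_inner_space) y"
  using cinner_scaleC_left[of "- 1" x y] by simp

lemma cinner_minus_right [simp]: "cinner x (- y) = - cinner (x::'a::complex_inner_space) y"
  using cinner_scaleC_right[of x "- 1" y] by simp

lemma cinner_diff_left: "cinner (x - y) z = cinner x z - cinner (y::'a::complex_inner_space) z"
  using cinner_add_left[of x "- y" z] by simp

lemma cinner_diff_right: "cinner z (x - y) = cinner z x - cinner z (y::'a::complex_inner_space)"
  using cinner_add_right[of z x "- y"] by simp

lemma cinner_zero_left [simp]: "cinner 0 (y::'a::complex_inner_space) = 0"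
  using cinner_diff_left[of 0 0 y] by simp

lemma cinner_zero_right [simp]: "cinner (y::'a::complex_inner_space) 0 = 0"
  using cinner_diff_right[of y 0 0] by simp

lemma cinner_eq_zero_commute:
  "cinner x y = 0 \<longleftrightarrow> cinner y (x::'a::complex_inner_space) = 0"
  by (metis cinner_commute complex_cnj_zero_iff)

lemma cinner_self_eq_zero [simp]: "cinner x x = 0 \<longleftrightarrow> (x::'a::complex_inner_space) = 0"
  by (simp add: cinner_self)

lemma cinner_sum_left:
  "cinner (\<Sum>i\<in>I. f i) y = (\<Sum>i\<in>I. cinner (f i) (y::'a::complex_inner_space))"
  by (induction I rule: infinite_finite_induct) (auto simp: cinner_add_left)

lemma norm_add_cinner:
  "(norm (x + y))\<^sup>2 = (norm x)\<^sup>2 + (norm y)\<^sup>2 + 2 * Re (cinner x (y::'a::complex_inner_space))"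
proof -
  have "complex_of_real ((norm (x + y))\<^sup>2) = cinner (x + y) (x + y)"
    by (simp add: cinner_self)
  also have "\<dots> = cinner x x + cinner y y + (cinner x y + cnj (cinner x y))"
    by (simp add: cinner_add_left cinner_add_right cinner_commute[of y x] algebra_simps)
  also have "\<dots> = complex_of_real ((norm x)\<^sup>2 + (norm y)\<^sup>2 + 2 * Re (cinner x y))"
    by (simp add: cinner_self complex_add_cnj)
  finally show ?thesis
    using of_real_eq_iff by blast
qed

lemma parallelogram_law:
  "(norm (x + y))\<^sup>2 + (norm (x - y))\<^sup>2 = 2 * (norm x)\<^sup>2 + 2 * (norm (y::'a::complex_inner_space))\<^sup>2"
  using norm_add_cinner[of x y] norm_add_cinner[of x "- y"] by simp

lemma norm_scaleC [simp]: "norm (a *\<^sub>C x) = cmod a * norm (x::'a::complex_inner_space)"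
proof -
  have "complex_of_real ((norm (a *\<^sub>C x))\<^sup>2) = a * cnj a * complex_of_real ((norm x)\<^sup>2)"
    using cinner_self[of "a *\<^sub>C x"] cinner_self[of x]
    by (simp add: cinner_scaleC_left cinner_scaleC_right mult_ac)
  also have "\<dots> = complex_of_real ((cmod a * norm x)\<^sup>2)"
    by (simp add: complex_norm_square[symmetric] power_mult_distrib)
  finally have "(norm (a *\<^sub>C x))\<^sup>2 = (cmod a * norm x)\<^sup>2"
    using of_real_eq_iff by blast
  then show ?thesis
    by (rule power2_eq_imp_eq) simp_all
qed

text \<open>Pythagoras for the orthogonal projection of \<open>x\<close> onto the line through
  \<open>m\<close>. It yields Cauchy-Schwarz and, later, the orthogonality of a nearest-point
  residual.\<close>

lemma norm_diff_projection:
  fixes x m :: "'a::complex_inner_space"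
  assumes "m \<noteq> 0"
  shows "(norm (x - (cinner x m / (norm m)\<^sup>2) *\<^sub>C m))\<^sup>2 = (norm x)\<^sup>2 - (cmod (cinner x m) / norm m)\<^sup>2"
proof -
  define c where "c = cinner x m / (norm m)\<^sup>2"
  have "(norm (x - c *\<^sub>C m))\<^sup>2 = (norm x)\<^sup>2 + (cmod c * norm m)\<^sup>2 - 2 * Re (cnj c * cinner x m)"
    using norm_add_cinner[of x "- (c *\<^sub>C m)"] by (simp add: cinner_scaleC_right)
  also have "cnj c * cinner x m = complex_of_real ((cmod (cinner x m) / norm m)\<^sup>2)"
    by (simp add: c_def power_divide mult.commute flip: complex_norm_square)
  also have "(cmod c * norm m)\<^sup>2 = (cmod (cinner x m) / norm m)\<^sup>2"
    using assms by (simp add: c_def norm_divide norm_power) (simp add: power2_eq_square)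
  finally show ?thesis
    by (simp add: c_def)
qed

lemma Cauchy_Schwarz_cinner: "cmod (cinner x y) \<le> norm x * norm (y::'a::complex_inner_space)"
proof (cases "y = 0")
  case False
  have "(cmod (cinner x y) / norm y)\<^sup>2 \<le> (norm x)\<^sup>2"
    using norm_diff_projection[OF False, of x]
    by (smt (verit) zero_le_power2)
  then have "cmod (cinner x y) / norm y \<le> norm x"
    by (rule power2_le_imp_le) simp
  with False show ?thesis
    by (simp add: pos_divide_le_eq)
qed simp

text \<open>Boundedness over the real structure is what gives limits, termwise sums and derivatives
  of expressions with complex scalars.\<close>

lemma bounded_bilinear_scaleC:
  "bounded_bilinear (scaleC :: complex \<Rightarrow> 'a \<Rightarrow> 'a::complex_inner_space)"
proof
  show "\<exists>K. \<forall>a x. norm (a *\<^sub>C (x::'a)) \<le> norm a * norm x * K"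
    by (rule exI[of _ 1]) simp
qed (auto simp: scaleC_add_left scaleC_add_right scaleC_scaleC
    scaleR_conv_of_real mult.commute simp flip: scaleC_of_real[where 'a='a])

lemma bounded_bilinear_cinner:
  "bounded_bilinear (cinner :: 'a \<Rightarrow> 'a::complex_inner_space \<Rightarrow> complex)"
proof
  show "\<exists>K. \<forall>x y. norm (cinner x (y::'a)) \<le> norm x * norm y * K"
    by (rule exI[of _ 1]) (simp add: Cauchy_Schwarz_cinner)
qed (auto simp: cinner_add_left cinner_add_right cinner_scaleC_left cinner_scaleC_right
    scaleR_conv_of_real simp flip: scaleC_of_real[where 'a='a])

lemmas bounded_linear_scaleC_left = bounded_bilinear.bounded_linear_left[OF bounded_bilinear_scaleC]
lemmas bounded_linear_scaleC_right = bounded_bilinear.bounded_linear_right[OF bounded_bilinear_scaleC]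
lemmas bounded_linear_cinner_left = bounded_bilinear.bounded_linear_left[OF bounded_bilinear_cinner]

subsection \<open>Orthogonal complements and adjoints\<close>

definition orthocomplement :: "'a::complex_inner_space set \<Rightarrow> 'a set"
  where "orthocomplement M = {x. \<forall>m\<in>M. cinner x m = 0}"

lemma csubspace_orthocomplement: "csubspace (orthocomplement M)"
  by (auto simp: orthocomplement_def complex_vector.subspace_def cinner_add_left cinner_scaleC_left)

lemma closed_orthocomplement: "closed (orthocomplement M)"
proof -
  have "orthocomplement M = (\<Inter>m\<in>M. (\<lambda>x. cinner x m) -` {0})"
    by (auto simp: orthocomplement_def)
  moreover have "closed ((\<lambda>x. cinner x m) -` {0})" for m :: 'a
    using continuous_on_closed_vimage[of UNIV "\<lambda>x. cinner x m"]
      linear_continuous_on[OF bounded_linear_cinner_left] by auto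
  ultimately show ?thesis
    by auto
qed

text \<open>Vanishing of the inner product is symmetric. This moves orthogonality from generating
  sets to their closed spans, one side at a time.\<close>

lemma subset_orthocomplement_commute:
  fixes A B :: "'a::complex_inner_space set"
  shows "A \<subseteq> orthocomplement B \<longleftrightarrow> B \<subseteq> orthocomplement A"
proof -
  have "B \<subseteq> orthocomplement A" if "A \<subseteq> orthocomplement B" for A B :: "'a set"
  proof
    fix b assume b: "b \<in> B"
    have "cinner b a = 0" if "a \<in> A" for a
      using \<open>A \<subseteq> orthocomplement B\<close> that b cinner_eq_zero_commute[of b a]
      by (auto simp: orthocomplement_def)
    then show "b \<in> orthocomplement A"
      by (simp add: orthocomplement_def)
  qed
  then show ?thesis
    by blast
qed

section \<open>Closed linear spans\<close>

lemma closed_cspan_minimal: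
  assumes "S \<subseteq> M" "csubspace M" "closed M"
  shows "closed_cspan S \<subseteq> M"
  unfolding closed_cspan_def
  using assms by (intro closure_minimal complex_vector.span_minimal)

lemma closed_cspan_superset: "S \<subseteq> closed_cspan S"
  unfolding closed_cspan_def
  using complex_vector.span_superset closure_subset by blast

lemma closed_closed_cspan: "closed (closed_cspan S)"
  by (simp add: closed_cspan_def)

lemma csubspace_closure:
  assumes "csubspace S"
  shows "csubspace (closure S)"
  unfolding complex_vector.subspace_def
proof (intro conjI ballI allI)
  show "0 \<in> closure S"
    using assms closure_subset complex_vector.subspace_0 by blast
next
  fix x y assume "x \<in> closure S" "y \<in> closure S"
  then obtain f g where fg: "\<forall>n. f n \<in> S" "f \<longlonglongrightarrow> x" "\<forall>n. g n \<in> S" "g \<longlonglongrightarrow> y"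
    unfolding closure_sequential by blast
  then have "\<forall>n. f n + g n \<in> S" "(\<lambda>n. f n + g n) \<longlonglongrightarrow> x + y"
    by (auto intro: tendsto_add complex_vector.subspace_add[OF assms])
  then show "x + y \<in> closure S"
    unfolding closure_sequential by (intro exI[of _ "\<lambda>n. f n + g n"]) simp
next
  fix c x assume "x \<in> closure S"
  then obtain f where f: "\<forall>n. f n \<in> S" "f \<longlonglongrightarrow> x"
    unfolding closure_sequential by blast
  then have "\<forall>n. c *\<^sub>C f n \<in> S" "(\<lambda>n. c *\<^sub>C f n) \<longlonglongrightarrow> c *\<^sub>C x"
    by (auto intro: bounded_linear.tendsto[OF bounded_linear_scaleC_right]
        complex_vector.subspace_scale[OF assms])
  then show "c *\<^sub>C x \<in> closure S"
    unfolding closure_sequential by (intro exI[of _ "\<lambda>n. c *\<^sub>C f n"]) simp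
qed

lemma csubspace_closed_cspan: "csubspace (closed_cspan S)"
  unfolding closed_cspan_def by (intro csubspace_closure complex_vector.subspace_span)

section \<open>Orthogonal projection onto a closed subspace\<close>

lemma nearest_point_csubspace:
  fixes x :: "'a::complex_hilbert_space"
  assumes M: "csubspace M" "closed M"
  obtains p where "p \<in> M" "\<And>m. m \<in> M \<Longrightarrow> norm (x - p) \<le> norm (x - m)"
proof -
  define D where "D = (INF m\<in>M. (norm (x - m))\<^sup>2)"
  have M0: "M \<noteq> {}"
    using complex_vector.subspace_0[OF M(1)] by auto
  have bdd: "bdd_below ((\<lambda>m. (norm (x - m))\<^sup>2) ` M)"
    by (rule bdd_belowI2[of _ 0]) simp
  have D_le: "D \<le> (norm (x - m))\<^sup>2" if "m \<in> M" for m
    unfolding D_def by (rule cINF_lower[OF bdd that])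
  have "\<exists>m\<in>M. (norm (x - m))\<^sup>2 < D + 1 / Suc n" for n
    using cINF_less_iff[OF M0 bdd, of "D + 1 / Suc n"] by (simp add: D_def)
  then obtain y where y: "\<And>n. y n \<in> M" "\<And>n. (norm (x - y n))\<^sup>2 < D + 1 / Suc n"
    by metis
  \<comment> \<open>Parallelogram law: the midpoint of \<open>y m\<close> and \<open>y n\<close>
    lies in \<open>M\<close>, at squared distance at least \<open>D\<close> from \<open>x\<close>,
    so the left side is at most \<open>2 (D + 1/(m+1)) + 2 (D + 1/(n+1)) - 4 D\<close>.\<close>
  have est: "(norm (y m - y n))\<^sup>2 \<le> 4 / Suc k" if "k \<le> m" "k \<le> n" for k m n
  proof -
    have "(1/2) *\<^sub>C (y m + y n) \<in> M"
      using y(1) M(1) by (intro complex_vector.subspace_scale complex_vector.subspace_add)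
    then have "D \<le> (norm (x - (1/2) *\<^sub>C (y m + y n)))\<^sup>2"
      by (rule D_le)
    moreover have "(x - y m) + (x - y n) = 2 *\<^sub>C (x - (1/2) *\<^sub>C (y m + y n))"
      using scaleC_of_real[of 2 x]
      by (simp add: complex_vector.scale_right_diff_distrib scaleC_scaleC scaleR_2)
    then have "(norm ((x - y m) + (x - y n)))\<^sup>2 = 4 * (norm (x - (1/2) *\<^sub>C (y m + y n)))\<^sup>2"
      by (simp add: power_mult_distrib)
    moreover have "(norm ((x - y m) - (x - y n)))\<^sup>2 = (norm (y m - y n))\<^sup>2"
      by (simp add: norm_minus_commute)
    moreover have "4 / real (Suc k) = 4 * (1 / Suc k)"
      by simp
    moreover have "1 / real (Suc m) \<le> 1 / Suc k" "1 / real (Suc n) \<le> 1 / Suc k"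
      using that by (auto intro!: divide_left_mono)
    ultimately show ?thesis
      using parallelogram_law[of "x - y m" "x - y n"] y(2)[of m] y(2)[of n]
      by linarith
  qed
  have "Cauchy y"
  proof (rule metric_CauchyI)
    fix e :: real assume e: "0 < e"
    then obtain k where "inverse (real (Suc k)) < e\<^sup>2 / 4"
      using reals_Archimedean[of "e\<^sup>2 / 4"] by auto
    then have "4 / real (Suc k) < e\<^sup>2"
      by (simp add: inverse_eq_divide)
    then have "dist (y m) (y n) < e" if "k \<le> m" "k \<le> n" for m n
      unfolding dist_norm
      by (rule power2_less_imp_less[OF le_less_trans[OF est[OF that]] less_imp_le[OF e]])
    then show "\<exists>k. \<forall>m\<ge>k. \<forall>n\<ge>k. dist (y m) (y n) < e"
      by blast
  qed
  then obtain p where p: "y \<longlonglongrightarrow> p"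
    using Cauchy_convergent convergent_def by blast
  show ?thesis
  proof
    show "p \<in> M"
      using M(2) y(1) p closed_sequentially by blast
    have "(\<lambda>n. (norm (x - y n))\<^sup>2) \<longlonglongrightarrow> (norm (x - p))\<^sup>2"
      by (intro tendsto_intros p)
    moreover have "(\<lambda>n. D + 1 / real (Suc n)) \<longlonglongrightarrow> D + 0"
      using LIMSEQ_inverse_real_of_nat
      by (intro tendsto_intros) (simp add: inverse_eq_divide)
    ultimately have "(norm (x - p))\<^sup>2 \<le> D"
      using y(2) by (intro LIMSEQ_le) (auto intro: less_imp_le)
    then show "norm (x - p) \<le> norm (x - m)" if "m \<in> M" for m
      by (rule power2_le_imp_le[OF order.trans[OF _ D_le[OF that]]]) simp
  qed
qed

lemma orthogonal_decomposition:
  fixes x :: "'a::complex_hilbert_space"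
  assumes M: "csubspace M" "closed M"
  obtains p q where "p \<in> M" "q \<in> orthocomplement M" "x = p + q"
proof -
  obtain p where p: "p \<in> M" "\<And>m. m \<in> M \<Longrightarrow> norm (x - p) \<le> norm (x - m)"
    using nearest_point_csubspace[OF M] by metis
  have "cinner (x - p) m = 0" if m: "m \<in> M" for m
  proof (cases "m = 0")
    case False
    \<comment> \<open>Adding to \<open>p\<close> the projection of the residual onto
      \<open>m\<close> lowers the squared distance by the square of
      \<open>cmod (cinner (x - p) m) / norm m\<close>, which minimality forces to be 0.\<close>
    let ?c = "cinner (x - p) m / (norm m)\<^sup>2"
    have "p + ?c *\<^sub>C m \<in> M"
      using M(1) p(1) m by (intro complex_vector.subspace_scale complex_vector.subspace_add)
    from p(2)[OF this] have "norm (x - p) \<le> norm (x - p - ?c *\<^sub>C m)"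
      by (simp add: diff_diff_eq)
    then have "(norm (x - p))\<^sup>2 \<le> (norm (x - p - ?c *\<^sub>C m))\<^sup>2"
      by (intro power_mono) auto
    then have "(cmod (cinner (x - p) m) / norm m)\<^sup>2 \<le> 0"
      using norm_diff_projection[OF False, of "x - p"] by linarith
    with False show ?thesis
      by (simp add: power_le_zero_eq)
  qed simp
  then show ?thesis
    using that[of p "x - p"] p(1) by (auto simp: orthocomplement_def)
qed

lemma orthocomplement_Int: "csubspace M \<Longrightarrow> M \<inter> orthocomplement M = {0}"
  using complex_vector.subspace_0 csubspace_orthocomplement
  by (auto simp: orthocomplement_def) 

lemma orthocomplement_orthocomplement:
  fixes M :: "'a::complex_hilbert_space set"
  assumes "csubspace M" "closed M"
  shows "orthocomplement (orthocomplement M) = M"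
proof
  show "M \<subseteq> orthocomplement (orthocomplement M)"
    by (rule subset_orthocomplement_commute[THEN iffD1]) simp
  show "orthocomplement (orthocomplement M) \<subseteq> M"
  proof
    fix x assume x: "x \<in> orthocomplement (orthocomplement M)"
    obtain p q where pq: "p \<in> M" "q \<in> orthocomplement M" "x = p + q"
      using orthogonal_decomposition[OF assms] by metis
    \<comment> \<open>\<open>q\<close> is orthogonal to \<open>x\<close> and to \<open>p\<close>,
      hence to their difference, which is \<open>q\<close> itself.\<close>
    then have "cinner x q = 0" "cinner p q = 0"
      using x by (auto simp: orthocomplement_def cinner_eq_zero_commute)
    then have "q = 0"
      using pq(3) by (simp add: cinner_add_left)
    with pq show "x \<in> M"
      by simp
  qed
qed

lemma Pythagoras_orthocomplement:
  assumes "p \<in> M" "q \<in> orthocomplement M"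
  shows "norm p \<le> norm (p + q)"
proof -
  have "cinner p q = 0"
    using assms by (auto simp: orthocomplement_def cinner_eq_zero_commute)
  then have "(norm p)\<^sup>2 \<le> (norm (p + q))\<^sup>2"
    using norm_add_cinner[of p q] by simp
  then show ?thesis
    by (rule power2_le_imp_le) simp
qed

text \<open>The kernel of a nonzero \<open>\<phi>\<close> is a closed hyperplane. Every
  \<open>y\<close> differs from a multiple of a fixed normal vector \<open>q\<close> by an element
  of the kernel, so \<open>cinner y q\<close> determines \<open>\<phi> y\<close> up to a constant
  factor.\<close>

lemma Riesz_representation:
  fixes \<phi> :: "'a::complex_hilbert_space \<Rightarrow> complex"
  assumes "bounded_linear \<phi>" and scale: "\<And>c x. \<phi> (c *\<^sub>C x) = c * \<phi> x"
  obtains z where "\<And>x. \<phi> x = cinner x z"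
proof (cases "\<forall>x. \<phi> x = 0")
  case True
  then show ?thesis
    using that[of 0] by simp
next
  case False
  interpret \<phi>: bounded_linear \<phi> by fact
  define M where "M = {x. \<phi> x = 0}"
  have "csubspace M"
    by (auto simp: M_def complex_vector.subspace_def \<phi>.add scale \<phi>.zero)
  moreover have "closed M"
    unfolding M_def
    using continuous_closed_preimage_constant[OF linear_continuous_on[OF assms(1), of UNIV] closed_UNIV]
    by simp
  moreover from False obtain x where "\<phi> x \<noteq> 0"
    by blast
  ultimately obtain p q where pq: "p \<in> M" "q \<in> orthocomplement M" "x = p + q"
    using orthogonal_decomposition by metis
  have q: "\<phi> q \<noteq> 0"
    using \<open>\<phi> x \<noteq> 0\<close> pq by (auto simp: M_def \<phi>.add)
  then have "q \<noteq> 0"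
    using \<phi>.zero by auto
  show ?thesis
  proof
    fix y
    have "y - (\<phi> y / \<phi> q) *\<^sub>C q \<in> M"
      using q by (simp add: M_def \<phi>.diff scale)
    then have "cinner (y - (\<phi> y / \<phi> q) *\<^sub>C q) q = 0"
      using pq(2) by (auto simp: orthocomplement_def cinner_eq_zero_commute)
    then have "cinner y q = (\<phi> y / \<phi> q) * cinner q q"
      by (simp add: cinner_diff_left cinner_scaleC_left)
    then show "\<phi> y = cinner y ((cnj (\<phi> q) / cinner q q) *\<^sub>C q)"
      using q \<open>q \<noteq> 0\<close> by (simp add: cinner_scaleC_right cinner_self)
  qed
qed

text \<open>\<open>cadjoint\<close> is a choice, so it has its defining property only once some
  adjoint is known to exist. Riesz representation supplies one, pointwise in
  \<open>y\<close>.\<close>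

lemma cinner_cadjoint:
  fixes T :: "'a::complex_hilbert_space \<Rightarrow> 'b::complex_inner_space"
  assumes T: "bounded_clinear T"
  shows "cinner (T x) y = cinner x (cadjoint T y)"
proof -
  have "\<exists>z. \<forall>x. cinner (T x) y = cinner x z" for y
  proof -
    have "bounded_linear (\<lambda>x. cinner (T x) y)"
      using T bounded_linear_compose[OF bounded_linear_cinner_left]
      unfolding bounded_clinear_def by blast
    moreover have "cinner (T (c *\<^sub>C x)) y = c * cinner (T x) y" for c x
      using T by (simp add: bounded_clinear_def cinner_scaleC_left)
    ultimately show ?thesis
      using Riesz_representation[of "\<lambda>x. cinner (T x) y"] by blast
  qed
  then have "\<exists>S. \<forall>x y. cinner (T x) y = cinner x (S y)"
    by metis
  then have "\<forall>x y. cinner (T x) y = cinner x (cadjoint T y)"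
    unfolding cadjoint_def by (rule someI_ex)
  then show ?thesis
    by blast
qed

text \<open>Eliminates the adjoint: from here on reducibility is a condition on \<open>T\<close>
  alone, symmetric in \<open>M\<close> and its complement. The backward direction lands in the
  double complement, which is \<open>M\<close> because \<open>M\<close> is closed.\<close>

lemma cadjoint_invariant_iff:
  fixes T :: "'a::complex_hilbert_space \<Rightarrow> 'a"
  assumes T: "bounded_clinear T" and M: "csubspace M" "closed M"
  shows "cadjoint T ` M \<subseteq> M \<longleftrightarrow> T ` orthocomplement M \<subseteq> orthocomplement M"
proof
  assume *: "cadjoint T ` M \<subseteq> M"
  show "T ` orthocomplement M \<subseteq> orthocomplement M"
    using * unfolding orthocomplement_def image_subset_iff
    by (auto intro: trans[OF cinner_cadjoint[OF T]])
next
  assume *: "T ` orthocomplement M \<subseteq> orthocomplement M"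
  have "cadjoint T y \<in> orthocomplement (orthocomplement M)" if y: "y \<in> M" for y
    unfolding orthocomplement_def[of "orthocomplement M"]
  proof (intro CollectI ballI)
    fix x assume "x \<in> orthocomplement M"
    then have "cinner (T x) y = 0"
      using * y by (auto simp: orthocomplement_def)
    then show "cinner (cadjoint T y) x = 0"
      by (subst cinner_eq_zero_commute) (simp add: cinner_cadjoint[OF T])
  qed
  then show "cadjoint T ` M \<subseteq> M"
    by (auto simp: orthocomplement_orthocomplement[OF M])
qed

subsection \<open>Open mapping theorem\<close>

text \<open>The Baire half of the open mapping theorem: the closures of the images of the balls of
  radius \<open>n\<close> cover the space, so one of them has an interior point.\<close>

lemma surjective_approximate_preimage:
  fixes A :: "'a::real_normed_vector \<Rightarrow> 'b::banach"
  assumes A: "bounded_linear A" and "surj A"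
  obtains K where "0 < K" "\<And>y. \<exists>x. norm x \<le> K * norm y \<and> norm (y - A x) \<le> norm y / 2"
proof -
  interpret A: bounded_linear A by fact
  define F where "F n = closure (A ` cball 0 (real n))" for n
  have "(\<Union>n. F n) = UNIV"
  proof -
    have "y \<in> (\<Union>n. F n)" for y
    proof -
      obtain x where x: "y = A x"
        using \<open>surj A\<close> by (metis surjD)
      obtain n where "norm x \<le> real n"
        using real_arch_simple by blast
      then have "y \<in> F n"
        unfolding F_def x using closure_subset by fastforce
      then show ?thesis
        by blast
    qed
    then show ?thesis
      by blast
  qed
  then have "interior (\<Union>n. F n) \<noteq> {}"
    by simp
  moreover have "interior (\<Union>n. F n) = {}" if "\<And>n. interior (F n) = {}"
  proof -
    have "euclidean interior_of (\<Union>(range F)) = {}"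
      using that by (intro Baire_category_alt) (auto simp: F_def completely_metrizable_space_euclidean)
    then show ?thesis
      by simp
  qed
  ultimately obtain n y0 where "y0 \<in> interior (F n)"
    by blast
  then obtain e where e: "0 < e" "ball y0 e \<subseteq> F n"
    using mem_interior by blast
  \<comment> \<open>Subtracting approximate preimages of \<open>y0 + y\<close> and \<open>y0\<close>
    moves the ball from \<open>y0\<close> to the origin, at the price of doubling the norm
    bound.\<close>
  have near: "\<exists>x. norm x \<le> 2 * real n \<and> norm (y - A x) < d" if "norm y < e" "0 < d" for y d
  proof -
    have "y0 + y \<in> F n" "y0 \<in> F n"
      using e that by (auto simp: dist_norm subset_iff)
    then obtain u v where uv: "norm u \<le> n" "norm (A u - (y0 + y)) < d / 2"
        "norm v \<le> n" "norm (A v - y0) < d / 2"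
      using \<open>0 < d\<close> unfolding F_def closure_approachable
      by (auto simp: dist_norm dest!: spec[of _ "d / 2"])
    have "norm (u - v) \<le> 2 * real n"
      using norm_triangle_ineq4[of u v] uv by linarith
    moreover have "y - A (u - v) = (A v - y0) - (A u - (y0 + y))"
      by (simp add: A.diff)
    then have "norm (y - A (u - v)) < d"
      using norm_triangle_ineq4[of "A v - y0" "A u - (y0 + y)"] uv(2,4) 
      by (smt (verit) field_sum_of_halves)
    ultimately show ?thesis
      by blast
  qed
  \<comment> \<open>A nonzero \<open>y\<close> is scaled to norm \<open>e / 2\<close> and its
    approximate preimage scaled back, which gives the factor \<open>2 / e\<close>. The summand 1
    keeps \<open>K\<close> positive when \<open>n = 0\<close>.\<close>
  define K where "K = (2 * real n + 1) * (2 / e)"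
  show ?thesis
  proof
    show "0 < K"
      using e by (simp add: K_def)
    fix y
    show "\<exists>x. norm x \<le> K * norm y \<and> norm (y - A x) \<le> norm y / 2"
    proof (cases "y = 0")
      case False
      define c where "c = e / (2 * norm y)"
      have c: "0 < c" "norm (c *\<^sub>R y) < e"
        using False e by (simp_all add: c_def)
      then obtain x where x: "norm x \<le> 2 * real n" "norm (c *\<^sub>R y - A x) < c * norm y / 2"
        using near[of "c *\<^sub>R y" "c * norm y / 2"] False by auto
      have "norm (inverse c *\<^sub>R x) \<le> inverse c * (2 * real n + 1)"
        using c x(1) by (simp add: mult_left_mono)
      also have "\<dots> = K * norm y"
        using e by (simp add: K_def c_def field_simps)
      finally have "norm (inverse c *\<^sub>R x) \<le> K * norm y" .
      moreover have "y - A (inverse c *\<^sub>R x) = inverse c *\<^sub>R (c *\<^sub>R y - A x)"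
        using c by (simp add: A.scaleR scaleR_diff_right)
      then have "norm (y - A (inverse c *\<^sub>R x)) \<le> norm y / 2"
        using c x(2) by (simp only: norm_scaleR) (simp add: field_simps)
      ultimately show ?thesis
        by blast
    qed (auto simp: A.zero)
  qed
qed

text \<open>Approximate preimages are improved by successive correction: each residual is at most
  half the previous one, so the corrections are absolutely summable, and completeness of the domain
  gives their sum.\<close>

lemma surjective_bounded_preimage:
  fixes A :: "'a::banach \<Rightarrow> 'b::banach"
  assumes A: "bounded_linear A" and "surj A"
  obtains K where "0 < K" "\<And>y. \<exists>x. A x = y \<and> norm x \<le> K * norm y"
proof -
  interpret A: bounded_linear A by fact
  obtain K where K: "0 < K" "\<And>y. \<exists>x. norm x \<le> K * norm y \<and> norm (y - A x) \<le> norm y / 2"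
    using surjective_approximate_preimage[OF assms] by metis
  then obtain g where g: "\<And>y. norm (g y) \<le> K * norm y" "\<And>y. norm (y - A (g y)) \<le> norm y / 2"
    by metis
  have "\<exists>x. A x = y \<and> norm x \<le> 2 * K * norm y" for y
  proof -
    \<comment> \<open>\<open>r n\<close> is the residual left after \<open>n\<close>
      corrections.\<close>
    define r where "r = (\<lambda>n. ((\<lambda>z. z - A (g z)) ^^ n) y)"
    have r_Suc: "r (Suc n) = r n - A (g (r n))" for n
      by (simp add: r_def)
    have r: "norm (r n) \<le> norm y * (1/2)^n" for n
    proof (induction n)
      case (Suc n)
      show ?case
        using g(2)[of "r n"] Suc by (simp add: r_Suc)
    qed (simp add: r_def)
    have bound: "norm (g (r n)) \<le> K * norm y * (1/2)^n" for n
      using order.trans[OF g(1)[of "r n"] mult_left_mono[OF r[of n], of K]] K(1) by (simp add: mult.assoc)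
    have geo: "(\<lambda>n. K * norm y * (1/2::real)^n) sums (K * norm y * 2)"
      using sums_mult[OF geometric_sums[of "1/2::real"], of "K * norm y"] by simp
    then have sg: "summable (\<lambda>n. norm (g (r n)))"
      by (intro summable_comparison_test[OF _ sums_summable[OF geo]]) (auto intro: bound)
    have "norm (\<Sum>n. g (r n)) \<le> (\<Sum>n. norm (g (r n)))"
      by (rule summable_norm[OF sg])
    also have "\<dots> \<le> K * norm y * 2"
      using suminf_le[OF bound sg sums_summable[OF geo]] sums_unique[OF geo] by simp
    finally have "norm (\<Sum>n. g (r n)) \<le> 2 * K * norm y"
      by simp
    moreover have "A (\<Sum>n. g (r n)) = y"
    proof -
      have "(\<lambda>n. A (g (r n))) sums A (\<Sum>n. g (r n))"
        by (intro A.sums summable_sums summable_norm_cancel[OF sg])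
      moreover have "r \<longlonglongrightarrow> 0"
      proof (rule Lim_null_comparison[of _ "\<lambda>n. norm y * (1/2)^n"])
        show "(\<lambda>n. norm y * (1/2::real)^n) \<longlonglongrightarrow> 0"
          by (intro tendsto_mult_right_zero LIMSEQ_realpow_zero) auto
      qed (simp add: r)
      \<comment> \<open>\<open>A (g (r n))\<close> is the drop from \<open>r n\<close> to
        \<open>r (Suc n)\<close>, so the images telescope to \<open>r 0 = y\<close>.\<close>
      then have "(\<lambda>n. r n - r (Suc n)) sums (r 0 - 0)"
        by (rule telescope_sums')
      then have "(\<lambda>n. A (g (r n))) sums y"
        by (simp add: r_Suc) (simp add: r_def)
      ultimately show ?thesis
        by (rule sums_unique2)
    qed
    ultimately show ?thesis
      by blast
  qed
  then show ?thesis
    using that[of "2 * K"] K(1) by simp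
qed

subsection \<open>Holomorphic families of eigenvectors\<close>

text \<open>The growth bound gives radius of convergence at least \<open>1 / K\<close>. On the disc
  of half that radius the terms and their derivatives are dominated uniformly by a geometric series
  of ratio 1/2 and by its derivative.\<close>

lemma power_series_holomorphic:
  fixes x :: "nat \<Rightarrow> 'a::complex_hilbert_space" and w0 :: complex
  assumes "0 < K" and x: "\<And>n. norm (x n) \<le> B * K ^ n"
  defines "f \<equiv> \<lambda>w. \<Sum>n. (w - w0) ^ n *\<^sub>C x n"
  shows "\<And>w. w \<in> ball w0 (1 / (2 * K)) \<Longrightarrow> (\<lambda>n. (w - w0) ^ n *\<^sub>C x n) sums f w"
    and "holomorphic_map_on f (ball w0 (1 / (2 * K)))"
proof -
  let ?S = "ball w0 (1 / (2 * K))"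
  have B: "0 \<le> B"
    using order.trans[OF norm_ge_zero x[of 0]] by simp
  have norm_w: "cmod (w - w0) \<le> 1 / (2 * K)" if "w \<in> ?S" for w
    using that by (simp add: dist_norm norm_minus_commute)
  show sums: "(\<lambda>n. (w - w0) ^ n *\<^sub>C x n) sums f w" if w: "w \<in> ?S" for w
    unfolding f_def
  proof (intro summable_sums summable_comparison_test[OF _ summable_mult[OF summable_geometric[of "1/2::real"], of B]] exI allI impI)
    fix n
    have "norm ((w - w0) ^ n *\<^sub>C x n) \<le> (1 / (2 * K)) ^ n * (B * K ^ n)"
      unfolding norm_scaleC norm_power
      using norm_w[OF w] x[of n] \<open>0 < K\<close> by (intro mult_mono power_mono) auto
    then show "norm ((w - w0) ^ n *\<^sub>C x n) \<le> B * (1/2) ^ n"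
      using \<open>0 < K\<close> by (simp add: power_divide power_mult_distrib)
  qed simp
  \<comment> \<open>The termwise derivatives, with majorants \<open>m n\<close>. At
    \<open>n = 0\<close> the truncated exponent \<open>n - 1\<close> is harmless because of the
    factor \<open>n\<close>.\<close>
  define D where "D n w = (of_nat n * (w - w0) ^ (n - 1)) *\<^sub>C x n" for n w
  define m where "m n = B * K * (real n * (1/2) ^ (n - 1))" for n
  have D: "norm (D n w) \<le> m n" if w: "w \<in> ?S" for n w
  proof (cases n)
    case (Suc k)
    have "norm (D n w) = real n * (cmod (w - w0) ^ k * norm (x n))"
      by (simp add: D_def Suc norm_mult norm_power del: of_nat_Suc)
    also have "\<dots> \<le> real n * ((1 / (2 * K)) ^ k * (B * K ^ n))"
      using norm_w[OF w] x[of n] \<open>0 < K\<close>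
      by (intro mult_left_mono mult_mono power_mono) auto
    also have "\<dots> = m n"
      using \<open>0 < K\<close> by (simp add: m_def Suc power_divide power_mult_distrib)
    finally show ?thesis .
  qed (simp add: D_def m_def)
  have "summable (\<lambda>n. m (Suc n))"
    unfolding m_def using geometric_deriv_sums[of "1/2::real"]
    by (intro summable_mult) (auto simp: sums_iff)
  then have "summable m"
    by (simp only: summable_Suc_iff)
  then have unif: "uniform_limit ?S (\<lambda>n w. \<Sum>i<n. D i w) (\<lambda>w. \<Sum>i. D i w) sequentially"
    using D by (intro Weierstrass_m_test)
  have "\<exists>g. \<forall>w\<in>?S. (\<lambda>n. (w - w0) ^ n *\<^sub>C x n) sums g w \<and>
      (g has_derivative (\<lambda>h. h *\<^sub>C (\<Sum>i. D i w))) (at w within ?S)"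
  proof (rule has_derivative_series[where f' = "\<lambda>n w h. h *\<^sub>C D n w" and x = w0])
    fix n w
    have "((\<lambda>w. (w - w0) ^ n) has_field_derivative of_nat n * (w - w0) ^ (n - 1)) (at w within ?S)"
      by (auto intro!: derivative_eq_intros)
    then have "((\<lambda>w. (w - w0) ^ n) has_derivative (\<lambda>h. h * (of_nat n * (w - w0) ^ (n - 1)))) (at w within ?S)"
      by (simp add: has_field_derivative_def mult_commute_abs)
    from bounded_linear.has_derivative[OF bounded_linear_scaleC_left this, of "x n"]
    show "((\<lambda>w. (w - w0) ^ n *\<^sub>C x n) has_derivative (\<lambda>h. h *\<^sub>C D n w)) (at w within ?S)"
      by (simp add: D_def scaleC_scaleC)
  next
    fix e :: real assume "0 < e"
    have "\<forall>\<^sub>F n in sequentially. \<forall>w\<in>?S. dist (\<Sum>i<n. D i w) (\<Sum>i. D i w) < e"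
      using unif \<open>0 < e\<close> by (simp add: uniform_limit_iff)
    then show "\<forall>\<^sub>F n in sequentially. \<forall>w\<in>?S. \<forall>h.
        norm ((\<Sum>i<n. h *\<^sub>C D i w) - h *\<^sub>C (\<Sum>i. D i w)) \<le> e * norm h"
    proof (rule eventually_mono, intro ballI allI)
      fix n w h assume *: "\<forall>w\<in>?S. dist (\<Sum>i<n. D i w) (\<Sum>i. D i w) < e" and "w \<in> ?S"
      have "(\<Sum>i<n. h *\<^sub>C D i w) - h *\<^sub>C (\<Sum>i. D i w) = h *\<^sub>C ((\<Sum>i<n. D i w) - (\<Sum>i. D i w))"
        by (simp add: complex_vector.scale_right_diff_distrib complex_vector.scale_sum_right)
      then have "norm ((\<Sum>i<n. h *\<^sub>C D i w) - h *\<^sub>C (\<Sum>i. D i w)) = cmod h * norm ((\<Sum>i<n. D i w) - (\<Sum>i. D i w))"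
        by simp
      also have "\<dots> \<le> cmod h * e"
        using * \<open>w \<in> ?S\<close> by (intro mult_left_mono) (auto simp: dist_norm less_imp_le)
      finally show "norm ((\<Sum>i<n. h *\<^sub>C D i w) - h *\<^sub>C (\<Sum>i. D i w)) \<le> e * norm h"
        by (simp add: mult.commute)
    qed
  next
    show "(\<lambda>n. (w0 - w0) ^ n *\<^sub>C x n) sums f w0"
      using \<open>0 < K\<close> by (intro sums) simp
  qed (use \<open>0 < K\<close> in auto)
  then obtain g where g: "\<And>w. w \<in> ?S \<Longrightarrow> (\<lambda>n. (w - w0) ^ n *\<^sub>C x n) sums g w"
    "\<And>w. w \<in> ?S \<Longrightarrow> (g has_derivative (\<lambda>h. h *\<^sub>C (\<Sum>i. D i w))) (at w within ?S)"
    by blast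
  \<comment> \<open>Termwise differentiation provides only some sum function \<open>g\<close>;
    uniqueness of sums identifies it with \<open>f\<close> on the disc.\<close>
  have "g w = f w" if "w \<in> ?S" for w
    using sums_unique2[OF g(1)[OF that] sums[OF that]] .
  then have "(f has_derivative (\<lambda>h. h *\<^sub>C (\<Sum>i. D i w))) (at w within ?S)" if "w \<in> ?S" for w
    using g(2)[OF that] that by (metis has_derivative_transform)
  then show "holomorphic_map_on f ?S"
    unfolding holomorphic_map_on_def by blast
qed

lemma holomorphic_map_on_imp_continuous_on: "holomorphic_map_on s V \<Longrightarrow> continuous_on V s"
  unfolding holomorphic_map_on_def continuous_on_eq_continuous_within
  using has_derivative_continuous by blast

lemma holomorphic_map_on_subset: "holomorphic_map_on s V \<Longrightarrow> W \<subseteq> V \<Longrightarrow> holomorphic_map_on s W"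
  unfolding holomorphic_map_on_def using has_derivative_subset by blast

section \<open>Eigenvectors inside a reducing subspace\<close>

lemma csubspace_eigenspace:
  assumes "bounded_clinear T"
  shows "csubspace (eigenspace T w)"
proof -
  interpret T: bounded_linear T
    using assms by (simp add: bounded_clinear_def)
  show ?thesis
    using assms unfolding bounded_clinear_def
    by (auto simp: complex_vector.subspace_def eigenspace_def T.add T.zero scaleC_add_right
        scaleC_scaleC mult.commute)
qed

definition reducing_subspace :: "('a::complex_hilbert_space \<Rightarrow> 'a) \<Rightarrow> 'a set \<Rightarrow> bool"
  where "reducing_subspace T M \<longleftrightarrow> csubspace M \<and> closed M \<and> T ` M \<subseteq> M \<and>
    T ` orthocomplement M \<subseteq> orthocomplement M"

text \<open>With \<open>T x - w x = 0\<close> this splits eigenvectors; with a general right-hand side in \<open>M\<close> it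
  transfers the surjectivity of \<open>T - w\<close> to the restriction of \<open>T\<close> to \<open>M\<close>.\<close>

lemma preimage_decomposition:
  fixes T :: "'a::complex_hilbert_space \<Rightarrow> 'a"
  assumes T: "bounded_clinear T" and red: "reducing_subspace T M"
    and x: "T x - w *\<^sub>C x \<in> M"
  obtains p q where "p \<in> M" "q \<in> orthocomplement M" "x = p + q" "q \<in> eigenspace T w"
    "T p - w *\<^sub>C p = T x - w *\<^sub>C x"
proof -
  have M: "csubspace M" "closed M" "T ` M \<subseteq> M" "T ` orthocomplement M \<subseteq> orthocomplement M"
    using red by (auto simp: reducing_subspace_def)
  interpret T: bounded_linear T
    using T by (simp add: bounded_clinear_def)
  obtain p q where pq: "p \<in> M" "q \<in> orthocomplement M" "x = p + q"
    using orthogonal_decomposition[OF M(1,2)] by metis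
  have eq: "T x - w *\<^sub>C x = (T p - w *\<^sub>C p) + (T q - w *\<^sub>C q)"
    by (simp add: pq(3) T.add scaleC_add_right)
  have "T p - w *\<^sub>C p \<in> M"
    using pq M by (intro complex_vector.subspace_diff complex_vector.subspace_scale) auto
  then have "T q - w *\<^sub>C q \<in> M"
    using x complex_vector.subspace_diff[OF M(1) x] eq by (metis add_diff_cancel_left')
  moreover have "T q - w *\<^sub>C q \<in> orthocomplement M"
    using pq M
    by (intro complex_vector.subspace_diff complex_vector.subspace_scale csubspace_orthocomplement) auto
  ultimately have "T q - w *\<^sub>C q = 0"
    using orthocomplement_Int[OF M(1)] by blast
  then show ?thesis
    using that pq eq by (auto simp: eigenspace_def)
qed

text \<open>Comparing Taylor coefficients at \<open>w0\<close> in \<open>(T - w) (s w) = 0\<close>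
  gives the recursion \<open>A (x 0) = 0\<close>, \<open>A (x (Suc n)) = x n\<close> for
  \<open>A = T - w0\<close>. It is solved inside \<open>M\<close> with at most geometric growth,
  which makes the series converge.\<close>

lemma eigenvector_holomorphic_extension:
  fixes T :: "'a::complex_hilbert_space \<Rightarrow> 'a"
  assumes T: "bounded_clinear T" and surj: "range (\<lambda>x. T x - w0 *\<^sub>C x) = UNIV"
    and red: "reducing_subspace T M"
    and x0: "x0 \<in> M" "x0 \<in> eigenspace T w0"
  obtains r s where "0 < r" "holomorphic_map_on s (ball w0 r)" "s w0 = x0"
    "\<And>w. w \<in> ball w0 r \<Longrightarrow> s w \<in> M \<inter> eigenspace T w"
proof -
  have M: "csubspace M" "closed M" "T ` M \<subseteq> M" "T ` orthocomplement M \<subseteq> orthocomplement M"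
    using red by (auto simp: reducing_subspace_def)
  interpret T: bounded_linear T
    using T by (simp add: bounded_clinear_def)
  define A where "A x = T x - w0 *\<^sub>C x" for x
  have A: "bounded_linear A"
    unfolding A_def by (intro bounded_linear_sub T.bounded_linear_axioms bounded_linear_scaleC_right)
  then interpret A: bounded_linear A .
  have scale: "A (c *\<^sub>C x) = c *\<^sub>C A x" for c x
    using T by (simp add: A_def bounded_clinear_def complex_vector.scale_right_diff_distrib
        scaleC_scaleC mult.commute)
  obtain K where K: "0 < K" "\<And>y. \<exists>x. A x = y \<and> norm x \<le> K * norm y"
    using surjective_bounded_preimage[OF A] surj unfolding A_def by metis
  \<comment> \<open>Projecting a preimage to \<open>M\<close> removes a component that
    \<open>A\<close> annihilates, so the image is unchanged, and it does not increase the
    norm.\<close>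
  have "\<exists>x\<in>M. A x = y \<and> norm x \<le> K * norm y" if y: "y \<in> M" for y
  proof -
    obtain x where x: "A x = y" "norm x \<le> K * norm y"
      using K(2) by blast
    moreover obtain p q where "p \<in> M" "q \<in> orthocomplement M" "x = p + q" "A p = A x"
      using preimage_decomposition[OF T red, of x w0] x(1) y unfolding A_def by metis
    ultimately show ?thesis
      using Pythagoras_orthocomplement[of p M q] by (intro bexI[of _ p]) auto
  qed
  then obtain g where g: "\<And>y. y \<in> M \<Longrightarrow> g y \<in> M" "\<And>y. y \<in> M \<Longrightarrow> A (g y) = y"
      "\<And>y. y \<in> M \<Longrightarrow> norm (g y) \<le> K * norm y"
    by metis
  define x where "x n = (g ^^ n) x0" for n
  have xM: "x n \<in> M" for n
    by (induction n) (auto simp: x_def x0 g)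
  have x_le: "norm (x n) \<le> norm x0 * K ^ n" for n
  proof (induction n)
    case (Suc n)
    have "norm (x (Suc n)) \<le> K * norm (x n)"
      using g(3)[OF xM[of n]] by (simp add: x_def)
    also have "\<dots> \<le> K * (norm x0 * K ^ n)"
      using K(1) Suc by (intro mult_left_mono) auto
    finally show ?case
      by (simp add: mult_ac)
  qed (simp add: x_def)
  have A0: "A (x 0) = 0" and A_Suc: "A (x (Suc n)) = x n" for n
    using x0 g(2)[OF xM[of n]] by (auto simp: x_def A_def eigenspace_def)
  define s where "s w = (\<Sum>n. (w - w0) ^ n *\<^sub>C x n)" for w
  note series = power_series_holomorphic[OF K(1) x_le, where ?w0.0 = w0, folded s_def]
  let ?S = "ball w0 (1 / (2 * K))"
  show ?thesis
  proof
    show "0 < 1 / (2 * K)"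
      using K(1) by simp
    show "holomorphic_map_on s ?S"
      by (rule series)
    \<comment> \<open>At the centre only the term \<open>n = 0\<close> survives, since
      \<open>0 ^ 0 = 1\<close>.\<close>
    have "(\<lambda>n. (w0 - w0) ^ n *\<^sub>C x n) sums ((w0 - w0) ^ 0 *\<^sub>C x 0)"
      using sums_finite[of "{0}" "\<lambda>n. (w0 - w0) ^ n *\<^sub>C x n"] by simp
    then show "s w0 = x0"
      by (simp add: s_def sums_iff x_def)
    fix w assume w: "w \<in> ?S"
    have "(\<Sum>i<n. (w - w0) ^ i *\<^sub>C x i) \<in> M" for n
      using M(1) xM by (intro complex_vector.subspace_sum complex_vector.subspace_scale)
    then have "s w \<in> M"
      using series(1)[OF w] M(2) unfolding sums_def by (rule closed_sequentially[rotated])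
    moreover have "(\<lambda>n. A ((w - w0) ^ n *\<^sub>C x n)) sums A (s w)"
      by (rule A.sums[OF series(1)[OF w]])
    \<comment> \<open>\<open>A\<close> kills the constant term and lowers every other coefficient
      index by one; the reindexed series is \<open>w - w0\<close> times the original.\<close>
    then have "(\<lambda>n. (w - w0) ^ Suc n *\<^sub>C x n) sums A (s w)"
      using sums_Suc_iff[of "\<lambda>n. A ((w - w0) ^ n *\<^sub>C x n)" "A (s w)"]
      by (simp add: scale A0 A_Suc)
    then have "(\<lambda>n. (w - w0) *\<^sub>C (w - w0) ^ n *\<^sub>C x n) sums A (s w)"
      by (simp add: scaleC_scaleC)
    moreover have "(\<lambda>n. (w - w0) *\<^sub>C (w - w0) ^ n *\<^sub>C x n) sums ((w - w0) *\<^sub>C s w)"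
      by (rule bounded_linear.sums[OF bounded_linear_scaleC_right series(1)[OF w]])
    ultimately have "A (s w) = (w - w0) *\<^sub>C s w"
      using sums_unique2 by blast
    then have "s w \<in> eigenspace T w"
      by (simp add: A_def eigenspace_def complex_vector.scale_left_diff_distrib)
    with \<open>s w \<in> M\<close> show "s w \<in> M \<inter> eigenspace T w"
      by blast
  qed
qed

subsection \<open>Orthonormal families\<close>

definition orthonormal :: "(nat \<Rightarrow> 'a::complex_inner_space) \<Rightarrow> nat \<Rightarrow> bool"
  where "orthonormal e k \<longleftrightarrow> (\<forall>i<k. \<forall>j<k. cinner (e i) (e j) = (if i = j then 1 else 0))"

text \<open>Translates the coefficient criterion for an indexed family into the two conditions in
  which \<open>holomorphic_subbundle\<close> expresses a frame.\<close>

lemma independent_familyI: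
  fixes v :: "nat \<Rightarrow> 'a::complex_inner_space"
  assumes v: "\<And>a j. (\<Sum>i<k. a i *\<^sub>C v i) = 0 \<Longrightarrow> j < k \<Longrightarrow> a j = 0"
  shows "inj_on v {..<k}" and "\<not> cdependent (v ` {..<k})"
proof -
  show inj: "inj_on v {..<k}"
  proof (rule inj_onI, rule ccontr)
    fix i j assume ij: "i \<in> {..<k}" "j \<in> {..<k}" "v i = v j" "i \<noteq> j"
    \<comment> \<open>A repeated vector satisfies the nontrivial relation with coefficients 1 and
      -1.\<close>
    let ?a = "\<lambda>l. if l = i then 1 else if l = j then - 1 else 0"
    have "(\<Sum>l<k. ?a l *\<^sub>C v l) = (\<Sum>l\<in>{i, j}. ?a l *\<^sub>C v l)"
      using ij by (intro sum.mono_neutral_right) auto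
    also have "\<dots> = 0"
      using ij by simp
    finally show False
      using v[of ?a i] ij by simp
  qed
  show "\<not> cdependent (v ` {..<k})"
  proof (rule complex_vector.independent_if_scalars_zero)
    fix f x assume "(\<Sum>x\<in>v ` {..<k}. f x *\<^sub>C x) = 0" and x: "x \<in> v ` {..<k}"
    then have "(\<Sum>i<k. (f \<circ> v) i *\<^sub>C v i) = 0"
      by (simp add: sum.reindex[OF inj])
    then show "f x = 0"
      using v[of "f \<circ> v"] x by auto
  qed simp
qed

text \<open>Compare coefficients at an index where their modulus is maximal.\<close>

lemma independent_near_orthonormal:
  assumes e: "orthonormal e k" and v: "\<And>j. j < k \<Longrightarrow> norm (v j - e j) < 1 / real (k + 1)"
  shows "inj_on v {..<k}" and "\<not> cdependent (v ` {..<k})"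
proof -
  have "a j = 0" if a: "(\<Sum>i<k. a i *\<^sub>C v i) = 0" and j: "j < k" for a j
  proof -
    obtain m where m: "m < k" "\<And>i. i < k \<Longrightarrow> cmod (a i) \<le> cmod (a m)"
    proof -
      have "finite ((\<lambda>i. cmod (a i)) ` {..<k})" "(\<lambda>i. cmod (a i)) ` {..<k} \<noteq> {}"
        using j by auto
      then have "Max ((\<lambda>i. cmod (a i)) ` {..<k}) \<in> (\<lambda>i. cmod (a i)) ` {..<k}"
        by (rule Max_in)
      then obtain m where "m < k" "Max ((\<lambda>i. cmod (a i)) ` {..<k}) = cmod (a m)"
        by auto
      then show ?thesis
        using that by (metis Max_ge finite_imageI finite_lessThan imageI lessThan_iff)
    qed
    have em: "norm (e m) = 1"
    proof (rule power2_eq_imp_eq)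
      have "complex_of_real ((norm (e m))\<^sup>2) = 1"
        using e m(1) unfolding cinner_self[symmetric] orthonormal_def by simp
      then show "(norm (e m))\<^sup>2 = 1\<^sup>2"
        by (simp only: of_real_eq_1_iff power_one)
    qed simp_all
    have "(\<Sum>i<k. a i * cinner (e i) (e m)) = (\<Sum>i<k. if i = m then a i else 0)"
      using e m(1) by (intro sum.cong) (auto simp: orthonormal_def)
    then have "(\<Sum>i<k. a i * cinner (e i) (e m)) = a m"
      using m(1) by simp
    moreover have "(\<Sum>i<k. a i * cinner (v i) (e m)) = 0"
      using arg_cong[OF a, of "\<lambda>x. cinner x (e m)"] by (simp add: cinner_sum_left cinner_scaleC_left)
    ultimately have "a m = - (\<Sum>i<k. a i * cinner (v i - e i) (e m))"
      by (simp add: cinner_diff_left right_diff_distrib sum_subtractf)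
    then have "cmod (a m) = cmod (\<Sum>i<k. a i * cinner (v i - e i) (e m))"
      by (simp only: norm_minus_cancel)
    also have "\<dots> \<le> (\<Sum>i<k. cmod (a i * cinner (v i - e i) (e m)))"
      by (rule norm_sum)
    \<comment> \<open>The \<open>k\<close> error terms add up to at most \<open>k / (k + 1)\<close>
      times \<open>cmod (a m)\<close>. This factor below 1 is what the radius
      \<open>1 / (k + 1)\<close> is chosen for.\<close>
    also have "\<dots> \<le> (\<Sum>i<k. cmod (a m) * (1 / real (k + 1)))"
    proof (rule sum_mono)
      fix i assume i: "i \<in> {..<k}"
      have "cmod (cinner (v i - e i) (e m)) \<le> norm (v i - e i)"
        using Cauchy_Schwarz_cinner[of "v i - e i" "e m"] em by simp
      then show "cmod (a i * cinner (v i - e i) (e m)) \<le> cmod (a m) * (1 / real (k + 1))"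
        unfolding norm_mult using m(2)[of i] v[of i] i by (intro mult_mono) auto
    qed
    also have "\<dots> = cmod (a m) * (real k / real (k + 1))"
      by simp
    finally have "cmod (a m) * (1 - real k / real (k + 1)) \<le> 0"
      by (simp add: right_diff_distrib)
    moreover have "0 < 1 - real k / real (k + 1)"
      by simp
    ultimately have "cmod (a m) \<le> 0"
      by (simp add: mult_le_0_iff)
    then show ?thesis
      using m(2)[OF j] by simp
  qed
  then show "inj_on v {..<k}" "\<not> cdependent (v ` {..<k})"
    using independent_familyI[of v k] by blast+
qed

section \<open>Orthonormal bases and dimension counts\<close>

lemma orthonormal_independent:
  assumes "orthonormal e k"
  shows "inj_on e {..<k}" and "\<not> cdependent (e ` {..<k})"
  using independent_near_orthonormal[OF assms, of e] by auto

text \<open>One Gram-Schmidt step: \<open>v\<close> minus its projection \<open>p\<close> onto the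
  span is nonzero because \<open>v\<close> lies outside the span, and is then normalised.\<close>

lemma orthonormal_extend:
  assumes V: "csubspace V" and e: "orthonormal e k" "e ` {..<k} \<subseteq> V"
    and v: "v \<in> V" "v \<notin> cspan (e ` {..<k})"
  obtains u where "orthonormal (e(k := u)) (Suc k)" "u \<in> V"
proof -
  define p where "p = (\<Sum>i<k. cinner v (e i) *\<^sub>C e i)"
  have p: "p \<in> cspan (e ` {..<k})"
    unfolding p_def
    by (intro complex_vector.span_sum complex_vector.span_scale complex_vector.span_base) auto
  then have "p \<in> V"
    using complex_vector.span_minimal[OF e(2) V] by blast
  have pj: "cinner (v - p) (e j) = 0" if "j < k" for j
  proof -
    have "cinner p (e j) = (\<Sum>i<k. cinner v (e i) * (if i = j then 1 else 0))"
      using e(1) that unfolding p_def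
      by (simp add: cinner_sum_left cinner_scaleC_left orthonormal_def)
    then show ?thesis
      using that by (simp add: cinner_diff_left if_distrib cong: if_cong)
  qed
  have np: "v - p \<noteq> 0"
    using p v(2) by auto
  define u where "u = complex_of_real (1 / norm (v - p)) *\<^sub>C (v - p)"
  have "norm u = 1"
    unfolding u_def norm_scaleC norm_of_real using np by simp
  then have "cinner u u = 1"
    by (simp add: cinner_self)
  moreover have "cinner u (e j) = 0" if "j < k" for j
    using pj[OF that] by (simp add: u_def cinner_scaleC_left)
  moreover from this have "cinner (e j) u = 0" if "j < k" for j
    using that by (simp add: cinner_eq_zero_commute)
  ultimately have "orthonormal (e(k := u)) (Suc k)"
    using e(1) by (auto simp: orthonormal_def less_Suc_eq)
  moreover have "u \<in> V"
    unfolding u_def using V v(1) \<open>p \<in> V\<close>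
    by (intro complex_vector.subspace_scale complex_vector.subspace_diff)
  ultimately show ?thesis
    by (rule that)
qed

text \<open>Orthonormal families in \<open>V\<close> are independent, so their length is bounded by
  \<open>card W\<close>. One of maximal length spans \<open>V\<close>, as otherwise a Gram-Schmidt
  step would lengthen it.\<close>

lemma orthonormal_basis_exists:
  assumes V: "csubspace V" and W: "V \<subseteq> cspan W" "finite W"
  obtains e where "orthonormal e (cdim V)" "cspan (e ` {..<cdim V}) = V"
proof -
  define P where "P k \<longleftrightarrow> (\<exists>e. orthonormal e k \<and> e ` {..<k} \<subseteq> V)" for k
  have "k \<le> card W" if k: "P k" for k
  proof -
    obtain e where e: "orthonormal e k" "e ` {..<k} \<subseteq> V"
      using k unfolding P_def by blast
    then have "card (e ` {..<k}) \<le> card W"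
      using complex_vector.independent_span_bound[OF W(2) orthonormal_independent(2)[OF e(1)]] W(1)
      by blast
    then show ?thesis
      by (simp add: card_image orthonormal_independent[OF e(1)])
  qed
  moreover have "P 0"
    by (simp add: P_def orthonormal_def)
  ultimately obtain k where k: "P k" "\<And>l. P l \<Longrightarrow> l \<le> k"
    using GreatestI_nat[of P 0 "card W"] Greatest_le_nat[of P _ "card W"] by blast
  then obtain e where e: "orthonormal e k" "e ` {..<k} \<subseteq> V"
    unfolding P_def by blast
  have span: "cspan (e ` {..<k}) = V"
  proof
    show "cspan (e ` {..<k}) \<subseteq> V"
      by (rule complex_vector.span_minimal[OF e(2) V])
    show "V \<subseteq> cspan (e ` {..<k})"
    proof (rule subsetI, rule ccontr)
      fix v assume "v \<in> V" "v \<notin> cspan (e ` {..<k})"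
      then obtain u where "orthonormal (e(k := u)) (Suc k)" "u \<in> V"
        using orthonormal_extend[OF V e] by metis
      then have "P (Suc k)"
        unfolding P_def using e(2) by (intro exI[of _ "e(k := u)"]) (auto simp: less_Suc_eq)
      then show False
        using k(2)[of "Suc k"] by simp
    qed
  qed
  moreover have "cdim V = k"
    using orthonormal_independent[OF e(1)] e(2) span
    by (intro complex_vector.dim_unique[of "e ` {..<k}"]) (auto simp: card_image)
  ultimately show ?thesis
    using that[of e] e(1) by simp
qed

text \<open>Orthonormal bases of \<open>A\<close> and \<open>B\<close> concatenate to an orthonormal
  basis of \<open>V\<close>; the family \<open>g\<close> lists the first and then, shifted by
  \<open>?k\<close>, the second.\<close>

lemma cdim_orthogonal_sum:
  assumes A: "csubspace A" "A \<subseteq> cspan W" and B: "csubspace B" "B \<subseteq> cspan W" and "finite W"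
    and orth: "\<And>x y. x \<in> A \<Longrightarrow> y \<in> B \<Longrightarrow> cinner x y = 0"
    and V: "A \<subseteq> V" "B \<subseteq> V" "V \<subseteq> A + B"
  shows "cdim V = cdim A + cdim B"
proof -
  let ?k = "cdim A" and ?l = "cdim B"
  obtain e where e: "orthonormal e ?k" "cspan (e ` {..<?k}) = A"
    using orthonormal_basis_exists[OF A \<open>finite W\<close>] by metis
  obtain f where f: "orthonormal f ?l" "cspan (f ` {..<?l}) = B"
    using orthonormal_basis_exists[OF B \<open>finite W\<close>] by metis
  define g where "g j = (if j < ?k then e j else f (j - ?k))" for j
  have eA: "e j \<in> A" if "j < ?k" for j
    by (subst e(2)[symmetric], rule complex_vector.span_base) (use that in simp)
  have fB: "f j \<in> B" if "j < ?l" for j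
    by (subst f(2)[symmetric], rule complex_vector.span_base) (use that in simp)
  have ef: "cinner (e i) (f j) = 0" "cinner (f j) (e i) = 0" if "i < ?k" "j < ?l" for i j
    using orth[OF eA fB, OF that] by (simp_all add: cinner_eq_zero_commute[of "f j"])
  have "cinner (g i) (g j) = (if i = j then 1 else 0)" if "i < ?k + ?l" "j < ?k + ?l" for i j
    using e(1) f(1) that ef[of i "j - ?k"] ef[of j "i - ?k"] unfolding g_def orthonormal_def
    by (cases "i < ?k"; cases "j < ?k") (auto simp: diff_less_mono)
  then have g: "orthonormal g (?k + ?l)"
    by (simp add: orthonormal_def)
  have "e ` {..<?k} \<subseteq> g ` {..<?k + ?l}"
    by (rule image_subsetI) (metis g_def image_eqI lessThan_iff trans_less_add1)
  moreover have "f ` {..<?l} \<subseteq> g ` {..<?k + ?l}"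
  proof
    fix y assume "y \<in> f ` {..<?l}"
    then obtain j where "j < ?l" "y = g (?k + j)"
      by (auto simp: g_def)
    then show "y \<in> g ` {..<?k + ?l}"
      by auto
  qed
  ultimately have "A \<subseteq> cspan (g ` {..<?k + ?l})" "B \<subseteq> cspan (g ` {..<?k + ?l})"
    using complex_vector.span_mono[of "e ` {..<?k}"] complex_vector.span_mono[of "f ` {..<?l}"] e(2) f(2)
    by simp_all
  then have "A + B \<subseteq> cspan (g ` {..<?k + ?l})"
    by (auto elim!: set_plus_elim intro!: complex_vector.span_add)
  then have "V \<subseteq> cspan (g ` {..<?k + ?l})"
    using V(3) by blast
  moreover have "g ` {..<?k + ?l} \<subseteq> V"
    using eA fB V by (auto simp: g_def)
  ultimately show ?thesis
    using orthonormal_independent[OF g]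
    by (intro complex_vector.dim_unique[of "g ` {..<?k + ?l}"]) (auto simp: card_image)
qed

text \<open>In infinite dimension \<open>cdim\<close> takes the default value 0, so a positive value
  certifies a finite basis. This is where positivity of the \<open>\<alpha> i\<close>
  enters.\<close>

lemma finite_span_if_cdim_pos:
  assumes "0 < cdim V"
  obtains W where "finite W" "V \<subseteq> cspan W"
  using complex_vector.basis_exists[of V] assms card_gt_0_iff by metis

text \<open>The set \<open>W\<close> excludes the default value of \<open>cdim\<close>. An
  independent set of full size spans, since adjoining a vector outside its span would exceed the
  dimension.\<close>

lemma independent_card_le_cdim:
  assumes W: "V \<subseteq> cspan W" "finite W" and S: "S \<subseteq> V" "\<not> cdependent S"
  shows "card S \<le> cdim V" and "card S = cdim V \<Longrightarrow> V \<subseteq> cspan S"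
proof -
  obtain B where B: "B \<subseteq> V" "\<not> cdependent B" "V \<subseteq> cspan B" "card B = cdim V"
    using complex_vector.basis_exists by blast
  have "finite B"
    using complex_vector.independent_span_bound[OF W(2) B(2)] B(1) W(1) by blast
  have le: "finite S \<and> card S \<le> cdim V" if "S \<subseteq> V" "\<not> cdependent S" for S
    using complex_vector.independent_span_bound[OF \<open>finite B\<close> that(2)] that(1) B by auto
  show "card S \<le> cdim V"
    using le[OF S] by blast
  show "V \<subseteq> cspan S" if "card S = cdim V"
  proof (rule subsetI, rule ccontr)
    fix x assume x: "x \<in> V" "x \<notin> cspan S"
    then have "\<not> cdependent (insert x S)"
      using complex_vector.independent_insertI S(2) by blast
    moreover have "x \<notin> S"
      using x(2) complex_vector.span_base by blast
    ultimately show False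
      using le[of "insert x S"] le[OF S] S x that by auto
  qed
qed

subsection \<open>Reducing subspaces and subbundles\<close>

lemma reducing_subspace_orthocomplement:
  "reducing_subspace T M \<Longrightarrow> reducing_subspace T (orthocomplement M)"
  by (simp add: reducing_subspace_def csubspace_orthocomplement closed_orthocomplement
      orthocomplement_orthocomplement)

lemma reducible_operator_iff:
  assumes "bounded_clinear T"
  shows "reducible_operator T \<longleftrightarrow> (\<exists>M. reducing_subspace T M \<and> M \<noteq> {0} \<and> M \<noteq> UNIV)"
proof -
  have "csubspace M \<and> closed M \<and> M \<noteq> {0} \<and> M \<noteq> UNIV \<and> T ` M \<subseteq> M \<and> cadjoint T ` M \<subseteq> M \<longleftrightarrow>
      reducing_subspace T M \<and> M \<noteq> {0} \<and> M \<noteq> UNIV" for M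
    using cadjoint_invariant_iff[OF assms, of M] by (auto simp only: reducing_subspace_def)
  then show ?thesis
    by (simp only: reducible_operator_def)
qed

lemma eigenvector_decomposition:
  assumes T: "bounded_clinear T" and M: "reducing_subspace T M" and x: "x \<in> eigenspace T w"
  obtains p q where "p \<in> M \<inter> eigenspace T w" "q \<in> orthocomplement M \<inter> eigenspace T w" "x = p + q"
proof -
  have M': "csubspace M"
    using M by (simp add: reducing_subspace_def)
  have x0: "T x - w *\<^sub>C x = 0"
    using x by (simp add: eigenspace_def)
  then have "T x - w *\<^sub>C x \<in> M"
    using complex_vector.subspace_0[OF M'] by simp
  then obtain p q where "p \<in> M" "q \<in> orthocomplement M" "x = p + q" "q \<in> eigenspace T w"
      "T p - w *\<^sub>C p = T x - w *\<^sub>C x"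
    using preimage_decomposition[OF T M] by metis
  then show ?thesis
    using that[of p q] x0 by (simp add: eigenspace_def)
qed

text \<open>An orthonormal basis of the part of the kernel in \<open>M\<close> is extended
  holomorphically, and stays independent as long as it moves little. This bounds the dimension
  nearby from below only; spanning is not yet claimed.\<close>

lemma reducing_frame:
  fixes T :: "'a::complex_hilbert_space \<Rightarrow> 'a"
  assumes T: "bounded_clinear T" and M: "reducing_subspace T M"
    and U: "open U" "w0 \<in> U" and surj: "range (\<lambda>x. T x - w0 *\<^sub>C x) = UNIV"
    and W: "eigenspace T w0 \<subseteq> cspan W" "finite W"
  defines "k \<equiv> cdim (M \<inter> eigenspace T w0)"
  obtains V s where "open V" "w0 \<in> V" "V \<subseteq> U"
    "\<And>j. j < k \<Longrightarrow> holomorphic_map_on (s j) V"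
    "\<And>j w. j < k \<Longrightarrow> w \<in> V \<Longrightarrow> s j w \<in> M \<inter> eigenspace T w"
    "\<And>w. w \<in> V \<Longrightarrow> inj_on (\<lambda>j. s j w) {..<k}"
    "\<And>w. w \<in> V \<Longrightarrow> \<not> cdependent ((\<lambda>j. s j w) ` {..<k})"
proof -
  have M': "csubspace M"
    using M by (simp add: reducing_subspace_def)
  have "csubspace (M \<inter> eigenspace T w0)"
    using complex_vector.subspace_inter M' csubspace_eigenspace[OF T] by blast
  then obtain e where e: "orthonormal e k" "cspan (e ` {..<k}) = M \<inter> eigenspace T w0"
    using orthonormal_basis_exists[of "M \<inter> eigenspace T w0" W] W unfolding k_def by blast
  define Q where "Q j V s \<longleftrightarrow> open V \<and> w0 \<in> V \<and> V \<subseteq> U \<and> holomorphic_map_on s V \<and>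
      (\<forall>w\<in>V. s w \<in> M \<inter> eigenspace T w \<and> norm (s w - e j) < 1 / real (k + 1))" for j V s
  have "\<exists>V s. Q j V s" if j: "j < k" for j
  proof -
    have "e j \<in> M \<inter> eigenspace T w0"
      by (subst e(2)[symmetric], rule complex_vector.span_base) (use j in simp)
    then obtain r s where rs: "0 < r" "holomorphic_map_on s (ball w0 r)" "s w0 = e j"
        "\<And>w. w \<in> ball w0 r \<Longrightarrow> s w \<in> M \<inter> eigenspace T w"
      using eigenvector_holomorphic_extension[OF T surj M] by blast
    define V where "V = ball w0 r \<inter> s -` ball (e j) (1 / real (k + 1)) \<inter> U"
    have "open (ball w0 r \<inter> s -` ball (e j) (1 / real (k + 1)))"
      by (intro continuous_open_preimage holomorphic_map_on_imp_continuous_on rs(2)) auto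
    then have "open V"
      using U(1) by (auto simp: V_def)
    moreover have "w0 \<in> V" "V \<subseteq> U" "V \<subseteq> ball w0 r"
      using rs U(2) by (auto simp: V_def)
    moreover have "norm (s w - e j) < 1 / real (k + 1)" if "w \<in> V" for w
      using that by (simp add: V_def dist_norm norm_minus_commute)
    ultimately have "Q j V s"
      using rs(2,4) holomorphic_map_on_subset[of s "ball w0 r" V] unfolding Q_def by blast
    then show ?thesis
      by blast
  qed
  then obtain V s where "\<And>j. j < k \<Longrightarrow> Q j (V j) (s j)"
    by metis
  then have Vs: "\<And>j. j < k \<Longrightarrow> open (V j)" "\<And>j. j < k \<Longrightarrow> w0 \<in> V j" "\<And>j. j < k \<Longrightarrow> V j \<subseteq> U"
      "\<And>j. j < k \<Longrightarrow> holomorphic_map_on (s j) (V j)"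
      "\<And>j w. j < k \<Longrightarrow> w \<in> V j \<Longrightarrow> s j w \<in> M \<inter> eigenspace T w"
      "\<And>j w. j < k \<Longrightarrow> w \<in> V j \<Longrightarrow> norm (s j w - e j) < 1 / real (k + 1)"
    unfolding Q_def by blast+
  \<comment> \<open>Intersecting with \<open>U\<close> keeps \<open>V'\<close> inside
    \<open>U\<close> also when \<open>k = 0\<close>, where the indexed intersection is
    everything.\<close>
  define V' where "V' = U \<inter> (\<Inter>j<k. V j)"
  have V': "V' \<subseteq> V j" if "j < k" for j
    using that by (auto simp: V'_def)
  show ?thesis
  proof
    show "open V'"
      unfolding V'_def using Vs(1) U(1) by (intro open_Int open_INT) auto
    show "w0 \<in> V'" "V' \<subseteq> U"
      using Vs(2) U(2) by (auto simp: V'_def)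
    show "holomorphic_map_on (s j) V'" if "j < k" for j
      by (rule holomorphic_map_on_subset[OF Vs(4) V']) (rule that)+
    show "s j w \<in> M \<inter> eigenspace T w" if "j < k" "w \<in> V'" for j w
      by (rule Vs(5)[OF that(1) subsetD[OF V'[OF that(1)] that(2)]])
    have near: "norm (s j w - e j) < 1 / real (k + 1)" if "w \<in> V'" "j < k" for w j
      by (rule Vs(6)[OF that(2) subsetD[OF V'[OF that(2)] that(1)]])
    show "inj_on (\<lambda>j. s j w) {..<k}" "\<not> cdependent ((\<lambda>j. s j w) ` {..<k})" if "w \<in> V'" for w
      by (rule independent_near_orthonormal[OF e(1) near[OF that]]; assumption)+
  qed
qed

text \<open>Near each point neither the part in \<open>M\<close> nor the part in the complement can
  lose dimension, and the two dimensions add up to \<open>n\<close>. Hence neither changes locally,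
  and a local independent family of the right size is a frame.\<close>

lemma holomorphic_subbundle_reducing:
  fixes T :: "'a::complex_hilbert_space \<Rightarrow> 'a"
  assumes T: "bounded_clinear T" and M: "reducing_subspace T M"
    and U: "open U" "connected U"
    and surj: "\<And>w. w \<in> U \<Longrightarrow> range (\<lambda>x. T x - w *\<^sub>C x) = UNIV"
    and dim: "\<And>w. w \<in> U \<Longrightarrow> cdim (eigenspace T w) = n" and "0 < n"
  shows "holomorphic_subbundle U {(w, x). w \<in> U \<and> x \<in> M \<inter> eigenspace T w} (kernel_bundle T U)"
    (is "holomorphic_subbundle U ?F ?E")
proof -
  let ?A = "\<lambda>w. M \<inter> eigenspace T w" and ?B = "\<lambda>w. orthocomplement M \<inter> eigenspace T w"
  have sub: "csubspace (?A w)" "csubspace (?B w)" for w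
    using M csubspace_eigenspace[OF T] csubspace_orthocomplement complex_vector.subspace_inter
    unfolding reducing_subspace_def by blast+
  have fin: "\<exists>W. finite W \<and> eigenspace T w \<subseteq> cspan W" if "w \<in> U" for w
    using finite_span_if_cdim_pos[of "eigenspace T w"] dim[OF that] \<open>0 < n\<close> by metis
  have dim_sum: "cdim (?A w) + cdim (?B w) = n" if w: "w \<in> U" for w
  proof -
    obtain W where "finite W" "eigenspace T w \<subseteq> cspan W"
      using fin[OF w] by blast
    moreover have "cinner x y = 0" if "x \<in> ?A w" "y \<in> ?B w" for x y
      using that cinner_eq_zero_commute[of x y] by (auto simp: orthocomplement_def)
    moreover have "eigenspace T w \<subseteq> ?A w + ?B w"
      using eigenvector_decomposition[OF T M] by (metis set_plus_intro subsetI)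
    ultimately have "cdim (eigenspace T w) = cdim (?A w) + cdim (?B w)"
      by (intro cdim_orthogonal_sum[OF sub(1) _ sub(2)]) auto
    then show ?thesis
      using dim[OF w] by simp
  qed
  \<comment> \<open>The local condition in \<open>holomorphic_subbundle\<close>, with the fibre
    written out and the rank still allowed to depend on \<open>w0\<close>.\<close>
  define frame where "frame w0 k V s \<longleftrightarrow> open V \<and> w0 \<in> V \<and> V \<subseteq> U \<and>
      (\<forall>j<k. holomorphic_section_on ?E (s j) V) \<and>
      (\<forall>w\<in>V. inj_on (\<lambda>j. s j w) {..<k} \<and>
        \<not> cdependent ((\<lambda>j. s j w) ` {..<k}) \<and>
        cspan ((\<lambda>j. s j w) ` {..<k}) = ?A w)" for w0 and k :: nat and V s
  have local_frame: "\<exists>V s. frame w0 (cdim (?A w0)) V s \<and> (\<forall>w\<in>V. cdim (?A w) = cdim (?A w0))"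
    if w0: "w0 \<in> U" for w0
  proof -
    obtain W where W: "finite W" "eigenspace T w0 \<subseteq> cspan W"
      using fin[OF w0] by blast
    obtain V s where V: "open V" "w0 \<in> V" "V \<subseteq> U"
        "\<And>j. j < cdim (?A w0) \<Longrightarrow> holomorphic_map_on (s j) V"
        "\<And>j w. j < cdim (?A w0) \<Longrightarrow> w \<in> V \<Longrightarrow> s j w \<in> ?A w"
        "\<And>w. w \<in> V \<Longrightarrow> inj_on (\<lambda>j. s j w) {..<cdim (?A w0)}"
        "\<And>w. w \<in> V \<Longrightarrow> \<not> cdependent ((\<lambda>j. s j w) ` {..<cdim (?A w0)})"
      by (rule reducing_frame[OF T M U(1) w0 surj[OF w0] W(2,1)]) blast
    obtain V' s' where V': "open V'" "w0 \<in> V'" "V' \<subseteq> U"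
        "\<And>j w. j < cdim (?B w0) \<Longrightarrow> w \<in> V' \<Longrightarrow> s' j w \<in> ?B w"
        "\<And>w. w \<in> V' \<Longrightarrow> inj_on (\<lambda>j. s' j w) {..<cdim (?B w0)}"
        "\<And>w. w \<in> V' \<Longrightarrow> \<not> cdependent ((\<lambda>j. s' j w) ` {..<cdim (?B w0)})"
      by (rule reducing_frame[OF T reducing_subspace_orthocomplement[OF M] U(1) w0 surj[OF w0] W(2,1)]) blast
    have main: "cdim (?A w) = cdim (?A w0) \<and> cspan ((\<lambda>j. s j w) ` {..<cdim (?A w0)}) = ?A w"
      if w: "w \<in> V \<inter> V'" for w
    proof -
      have wU: "w \<in> U"
        using w V(3) by blast
      then obtain W' where W': "finite W'" "eigenspace T w \<subseteq> cspan W'"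
        using fin by blast
      then have WA: "?A w \<subseteq> cspan W'" and WB: "?B w \<subseteq> cspan W'"
        by auto
      let ?S = "(\<lambda>j. s j w) ` {..<cdim (?A w0)}" and ?S' = "(\<lambda>j. s' j w) ` {..<cdim (?B w0)}"
      have S: "?S \<subseteq> ?A w" "\<not> cdependent ?S" "card ?S = cdim (?A w0)"
        using V w by (auto simp: card_image)
      have S': "?S' \<subseteq> ?B w" "\<not> cdependent ?S'" "card ?S' = cdim (?B w0)"
        using V' w by (auto simp: card_image)
      have "cdim (?A w0) \<le> cdim (?A w)" "cdim (?B w0) \<le> cdim (?B w)"
        using independent_card_le_cdim(1)[OF WA W'(1) S(1,2)]
          independent_card_le_cdim(1)[OF WB W'(1) S'(1,2)] S(3) S'(3) by simp_all
      \<comment> \<open>Two lower bounds whose sums agree must both be equalities.\<close>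
      then have eq: "cdim (?A w) = cdim (?A w0)"
        using dim_sum[OF wU] dim_sum[OF w0] by linarith
      then have "?A w \<subseteq> cspan ?S"
        using independent_card_le_cdim(2)[OF WA W'(1) S(1,2)] S(3) by simp
      moreover have "cspan ?S \<subseteq> ?A w"
        by (rule complex_vector.span_minimal[OF S(1) sub(1)])
      ultimately show ?thesis
        using eq by blast
    qed
    have "holomorphic_section_on ?E (s j) (V \<inter> V')" if "j < cdim (?A w0)" for j
      using V(3,4,5) that holomorphic_map_on_subset[of "s j" V "V \<inter> V'"]
      by (auto simp: holomorphic_section_on_def fibre_def kernel_bundle_def)
    then have "frame w0 (cdim (?A w0)) (V \<inter> V') s"
      unfolding frame_def
    proof (intro conjI allI impI ballI)
      show "open (V \<inter> V')" "w0 \<in> V \<inter> V'" "V \<inter> V' \<subseteq> U"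
        using V(1,2,3) V'(1,2) by auto
      fix w assume w: "w \<in> V \<inter> V'"
      then show "inj_on (\<lambda>j. s j w) {..<cdim (?A w0)}"
          "\<not> cdependent ((\<lambda>j. s j w) ` {..<cdim (?A w0)})"
        using V(6,7) by (meson IntE)+
      show "cspan ((\<lambda>j. s j w) ` {..<cdim (?A w0)}) = ?A w"
        using main[OF w] by simp
    qed
    moreover have "\<forall>w\<in>V \<inter> V'. cdim (?A w) = cdim (?A w0)"
      using main by simp
    ultimately show ?thesis
      by (intro exI[of _ "V \<inter> V'"] exI[of _ s] conjI)
  qed
  \<comment> \<open>Connectedness of \<open>U\<close> yields the single rank \<open>k\<close> that a
    subbundle must have.\<close>
  have "(\<lambda>w. cdim (?A w)) constant_on U"
  proof (rule locally_constant_imp_constant[OF U(2)])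
    fix w0 assume "w0 \<in> U"
    then obtain V s where "frame w0 (cdim (?A w0)) V s" and V: "\<forall>w\<in>V. cdim (?A w) = cdim (?A w0)"
      using local_frame[OF \<open>w0 \<in> U\<close>] by (elim exE conjE)
    then have "open V" "w0 \<in> V" "V \<subseteq> U"
      by (simp_all add: frame_def)
    with V show "\<exists>V. openin (top_of_set U) V \<and> w0 \<in> V \<and> (\<forall>w\<in>V. cdim (?A w) = cdim (?A w0))"
      by (intro exI[of _ V] conjI open_subset)
  qed
  then obtain k where k: "\<And>w. w \<in> U \<Longrightarrow> cdim (?A w) = k"
    by (auto simp: constant_on_def)
  have fibre: "fibre ?F w = ?A w" if "w \<in> U" for w
    using that by (auto simp: fibre_def)
  show ?thesis
    unfolding holomorphic_subbundle_def
  proof (intro conjI exI[of _ k] ballI)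
    show "?F \<subseteq> ?E" "?F \<subseteq> U \<times> UNIV"
      by (auto simp: kernel_bundle_def)
    fix w0 assume "w0 \<in> U"
    then obtain V s where "frame w0 k V s"
      using local_frame[OF \<open>w0 \<in> U\<close>] unfolding k[OF \<open>w0 \<in> U\<close>] by (elim exE conjE)
    then show "\<exists>V s. open V \<and> w0 \<in> V \<and> V \<subseteq> U \<and>
        (\<forall>j<k. holomorphic_section_on ?E (s j) V) \<and>
        (\<forall>w\<in>V. inj_on (\<lambda>j. s j w) {..<k} \<and> \<not> cdependent ((\<lambda>j. s j w) ` {..<k}) \<and>
          cspan ((\<lambda>j. s j w) ` {..<k}) = fibre ?F w)"
      using fibre by (intro exI[of _ V] exI[of _ s]) (simp add: frame_def subset_iff)
  qed
qed

section \<open>From a reducing subspace to a splitting of the kernel bundle\<close>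

lemma Sigma_eq_iff: "Sigma I A = Sigma I B \<longleftrightarrow> (\<forall>i\<in>I. A i = B i)"
  by (auto simp: set_eq_iff)

lemma reducible_kernel_bundle_if_reducible_operator:
  fixes T :: "'a::complex_hilbert_space \<Rightarrow> 'a"
  assumes T: "bounded_clinear T" and red: "reducible_operator T"
    and C: "\<And>i. i \<in> indices N \<Longrightarrow> open (C i)" "\<And>i. i \<in> indices N \<Longrightarrow> connected (C i)"
    and surj: "\<And>i w. i \<in> indices N \<Longrightarrow> w \<in> C i \<Longrightarrow> range (\<lambda>x. T x - w *\<^sub>C x) = UNIV"
    and dim: "\<And>i w. i \<in> indices N \<Longrightarrow> w \<in> C i \<Longrightarrow> cdim (eigenspace T w) = \<alpha> i"
    and \<alpha>: "\<And>i. i \<in> indices N \<Longrightarrow> 0 < \<alpha> i"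
    and total: "closed_cspan (\<Union>i\<in>indices N. \<Union>w\<in>C i. eigenspace T w) = UNIV"
  shows "reducible_kernel_bundle T N C"
proof -
  obtain M where M: "reducing_subspace T M" and M_nontriv: "M \<noteq> {0}" "M \<noteq> UNIV"
    using red unfolding reducible_operator_iff[OF T] by blast
  then have M': "csubspace M" "closed M"
    by (auto simp: reducing_subspace_def)
  define E where "E L i = {(w, x). w \<in> C i \<and> x \<in> L \<inter> eigenspace T w}" for L :: "'a set" and i
  have sub: "holomorphic_subbundle (C i) (E L i) (kernel_bundle T (C i))"
    if "i \<in> indices N" "reducing_subspace T L" for i L
    unfolding E_def using that C surj dim \<alpha> by (intro holomorphic_subbundle_reducing[OF T]) auto
  have fibre: "fibre (E L i) w = L \<inter> eigenspace T w" if "w \<in> C i" for L i w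
    using that by (auto simp: E_def fibre_def)
  \<comment> \<open>Totality of the eigenvectors: a closed subspace containing every eigenspace is
    the whole space. Both nontriviality arguments below rest on this.\<close>
  have all: "L = UNIV" if L: "csubspace L" "closed L"
    and le: "\<And>i w. i \<in> indices N \<Longrightarrow> w \<in> C i \<Longrightarrow> eigenspace T w \<subseteq> L" for L
    using closed_cspan_minimal[of "\<Union>i\<in>indices N. \<Union>w\<in>C i. eigenspace T w" L] L le total by blast
  have full: False if L: "reducing_subspace T L" "L \<noteq> UNIV"
    and eq: "Sigma (indices N) (E L) = kernel_bundle_union T N C" for L
  proof -
    have "eigenspace T w \<subseteq> L" if "i \<in> indices N" "w \<in> C i" for i w
      using eq that unfolding kernel_bundle_union_def Sigma_eq_iff by (auto simp: E_def kernel_bundle_def)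
    then show False
      using all[of L] L unfolding reducing_subspace_def by blast
  qed
  \<comment> \<open>If \<open>L\<close> meets every eigenspace trivially, the component in
    \<open>L\<close> of each eigenvector vanishes, so all eigenvectors lie in the
    complement.\<close>
  have zero: False if L: "reducing_subspace T L" "orthocomplement L \<noteq> UNIV"
    and eq: "Sigma (indices N) (E L) = (SIGMA i : indices N. C i \<times> {0})" for L
  proof -
    have "eigenspace T w \<subseteq> orthocomplement L" if iw: "i \<in> indices N" "w \<in> C i" for i w
    proof
      fix x assume "x \<in> eigenspace T w"
      then obtain p q where pq: "p \<in> L \<inter> eigenspace T w" "q \<in> orthocomplement L" "x = p + q"
        using eigenvector_decomposition[OF T L(1)] by (metis IntE)
      have "(w, p) \<in> C i \<times> {0}"
        using eq iw pq(1) unfolding Sigma_eq_iff by (auto simp: E_def)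
      then show "x \<in> orthocomplement L"
        using pq by simp
    qed
    then show False
      using all[OF csubspace_orthocomplement closed_orthocomplement] L(2) by blast
  qed
  \<comment> \<open>These make \<open>full\<close> and \<open>zero\<close> applicable to the
    complement as well as to \<open>M\<close>, covering all four nontriviality conditions.\<close>
  have perp: "orthocomplement M \<noteq> UNIV" "orthocomplement (orthocomplement M) \<noteq> UNIV"
    using orthocomplement_Int[OF M'(1)] M_nontriv orthocomplement_orthocomplement[OF M'] by auto
  note M2 = reducing_subspace_orthocomplement[OF M]
  have direct: "fibre (E M i) w + fibre (E (orthocomplement M) i) w = fibre (kernel_bundle T (C i)) w"
      "fibre (E M i) w \<inter> fibre (E (orthocomplement M) i) w = {0}"
    if "i \<in> indices N" "w \<in> C i" for i w
  proof -
    have "fibre (kernel_bundle T (C i)) w = eigenspace T w"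
      using that by (simp add: fibre_def kernel_bundle_def)
    moreover have "(M \<inter> eigenspace T w) + (orthocomplement M \<inter> eigenspace T w) = eigenspace T w"
    proof
      show "(M \<inter> eigenspace T w) + (orthocomplement M \<inter> eigenspace T w) \<subseteq> eigenspace T w"
        using complex_vector.subspace_add[OF csubspace_eigenspace[OF T]] by (auto elim!: set_plus_elim)
      show "eigenspace T w \<subseteq> (M \<inter> eigenspace T w) + (orthocomplement M \<inter> eigenspace T w)"
        using eigenvector_decomposition[OF T M] by (metis set_plus_intro subsetI)
    qed
    moreover have "0 \<in> eigenspace T w"
      by (rule complex_vector.subspace_0[OF csubspace_eigenspace[OF T]])
    ultimately show "fibre (E M i) w + fibre (E (orthocomplement M) i) w = fibre (kernel_bundle T (C i)) w"
        "fibre (E M i) w \<inter> fibre (E (orthocomplement M) i) w = {0}"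
      using orthocomplement_Int[OF M'(1)] by (auto simp: fibre[OF that(2)])
  qed
  have orth: "cinner x y = 0"
    if "i \<in> indices N" "j \<in> indices N" "x \<in> closed_cspan (\<Union>w\<in>C i. fibre (E M i) w)"
      "y \<in> closed_cspan (\<Union>w\<in>C j. fibre (E (orthocomplement M) j) w)" for i j x y
  proof -
    have "x \<in> M"
      using closed_cspan_minimal[of "\<Union>w\<in>C i. fibre (E M i) w", OF _ M'] fibre that(3) by blast
    moreover have "y \<in> orthocomplement M"
      using closed_cspan_minimal[of "\<Union>w\<in>C j. fibre (E (orthocomplement M) j) w",
          OF _ csubspace_orthocomplement closed_orthocomplement] fibre that(4) by blast
    ultimately show ?thesis
      using cinner_eq_zero_commute[of x y] by (simp add: orthocomplement_def)
  qed
  show ?thesis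
    unfolding reducible_kernel_bundle_def
    by (rule exI[of _ "E M"], rule exI[of _ "E (orthocomplement M)"], intro conjI ballI notI)
      (fact sub[OF _ M] sub[OF _ M2] zero[OF M perp(1)] full[OF M M_nontriv(2)]
      zero[OF M2 perp(2)] full[OF M2 perp(1)] direct orth)+
qed

section \<open>From a splitting of the kernel bundle to a reducing subspace\<close>

lemma reducible_operator_if_reducible_kernel_bundle:
  fixes T :: "'a::complex_hilbert_space \<Rightarrow> 'a"
  assumes T: "bounded_clinear T" and red: "reducible_kernel_bundle T N C"
    and total: "closed_cspan (\<Union>i\<in>indices N. \<Union>w\<in>C i. eigenspace T w) = UNIV"
  shows "reducible_operator T"
proof -
  interpret T: bounded_linear T
    using T by (simp add: bounded_clinear_def)
  obtain E1 E2 :: "nat \<Rightarrow> (complex \<times> 'a) set" where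
    sub: "\<forall>i\<in>indices N. holomorphic_subbundle (C i) (E1 i) (kernel_bundle T (C i))"
      "\<forall>i\<in>indices N. holomorphic_subbundle (C i) (E2 i) (kernel_bundle T (C i))"
    and nz: "Sigma (indices N) E1 \<noteq> (SIGMA i : indices N. C i \<times> {0})"
      "Sigma (indices N) E2 \<noteq> (SIGMA i : indices N. C i \<times> {0})"
    and sum: "\<forall>i\<in>indices N. \<forall>w\<in>C i.
        fibre (E1 i) w + fibre (E2 i) w = fibre (kernel_bundle T (C i)) w \<and>
        fibre (E1 i) w \<inter> fibre (E2 i) w = {0}"
    and orth: "\<forall>i\<in>indices N. \<forall>j\<in>indices N.
        \<forall>x\<in>closed_cspan (\<Union>w\<in>C i. fibre (E1 i) w).
        \<forall>y\<in>closed_cspan (\<Union>w\<in>C j. fibre (E2 j) w). cinner x y = 0"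
    using red unfolding reducible_kernel_bundle_def by (elim exE conjE) (rule that; assumption)
  define S where "S E = (\<Union>i\<in>indices N. \<Union>w\<in>C i. fibre (E i) w)" for E :: "nat \<Rightarrow> (complex \<times> 'a) set"
  \<comment> \<open>The closed span is taken over all components at once; \<open>M E1\<close> will
    be the reducing subspace.\<close>
  define M where "M E = closed_cspan (S E)" for E
  have M: "csubspace (M E)" "closed (M E)" "S E \<subseteq> M E" for E
    by (simp_all add: M_def csubspace_closed_cspan closed_closed_cspan closed_cspan_superset)
  have "cinner x y = 0" if "x \<in> S E1" "y \<in> S E2" for x y
  proof -
    obtain i w where iw: "i \<in> indices N" "w \<in> C i" "x \<in> fibre (E1 i) w"
      using \<open>x \<in> S E1\<close> by (auto simp: S_def)
    obtain j v where jv: "j \<in> indices N" "v \<in> C j" "y \<in> fibre (E2 j) v"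
      using \<open>y \<in> S E2\<close> by (auto simp: S_def)
    have "x \<in> (\<Union>w\<in>C i. fibre (E1 i) w)" "y \<in> (\<Union>w\<in>C j. fibre (E2 j) w)"
      using iw(2,3) jv(2,3) by auto
    then show ?thesis
      by (intro orth[rule_format, OF iw(1) jv(1)] subsetD[OF closed_cspan_superset])
  qed
  then have "S E1 \<subseteq> orthocomplement (S E2)"
    by (auto simp: orthocomplement_def)
  then have "M E1 \<subseteq> orthocomplement (S E2)"
    unfolding M_def by (intro closed_cspan_minimal csubspace_orthocomplement closed_orthocomplement)
  then have "S E2 \<subseteq> orthocomplement (M E1)"
    by (simp only: subset_orthocomplement_commute)
  then have M_orth: "M E2 \<subseteq> orthocomplement (M E1)"
    unfolding M_def[of E2] by (intro closed_cspan_minimal csubspace_orthocomplement closed_orthocomplement)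
  have "orthocomplement (M E1) \<subseteq> M E2"
  proof
    fix x assume x: "x \<in> orthocomplement (M E1)"
    obtain p q where pq: "p \<in> M E2" "q \<in> orthocomplement (M E2)" "x = p + q"
      by (rule orthogonal_decomposition[OF M(1,2)])
    have "x - p \<in> orthocomplement (M E1)"
      by (rule complex_vector.subspace_diff[OF csubspace_orthocomplement x subsetD[OF M_orth pq(1)]])
    then have q: "q \<in> orthocomplement (M E1)"
      by (simp add: pq(3))
    \<comment> \<open>The remainder \<open>q\<close> is orthogonal to both closed spans, and each
      eigenvector is a sum of a vector from each. So \<open>q\<close> is orthogonal to a total set,
      hence to itself.\<close>
    have "eigenspace T w \<subseteq> orthocomplement {q}" if iw: "i \<in> indices N" "w \<in> C i" for i w
    proof
      fix y assume "y \<in> eigenspace T w"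
      then have "y \<in> fibre (E1 i) w + fibre (E2 i) w"
        using sum[rule_format, OF iw] iw by (simp add: fibre_def kernel_bundle_def)
      then obtain a b where ab: "a \<in> fibre (E1 i) w" "b \<in> fibre (E2 i) w" "y = a + b"
        by (rule set_plus_elim)
      then have "a \<in> M E1" "b \<in> M E2"
        using M(3) iw by (auto simp: S_def)
      then have "cinner q a = 0" "cinner q b = 0"
        using q pq(2) by (auto simp: orthocomplement_def)
      then show "y \<in> orthocomplement {q}"
        by (simp add: orthocomplement_def ab(3) cinner_eq_zero_commute[of _ q] cinner_add_right)
    qed
    then have "closed_cspan (\<Union>i\<in>indices N. \<Union>w\<in>C i. eigenspace T w) \<subseteq> orthocomplement {q}"
      by (intro closed_cspan_minimal csubspace_orthocomplement closed_orthocomplement) blast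
    then have "q \<in> orthocomplement {q}"
      by (simp add: total top_unique)
    then have "q = 0"
      by (simp add: orthocomplement_def)
    then show "x \<in> M E2"
      using pq by simp
  qed
  with M_orth have perp: "orthocomplement (M E1) = M E2"
    by blast
  \<comment> \<open>Generators of \<open>M E\<close> are eigenvectors, which \<open>T\<close> merely
    rescales; the preimage of \<open>M E\<close> under \<open>T\<close> is a closed subspace, so it
    contains the whole closed span.\<close>
  have inv: "T ` M E \<subseteq> M E"
    if sub: "\<forall>i\<in>indices N. holomorphic_subbundle (C i) (E i) (kernel_bundle T (C i))" for E
  proof -
    have "M E \<subseteq> T -` M E"
      unfolding M_def[of E]
    proof (rule closed_cspan_minimal)
      show "S E \<subseteq> T -` closed_cspan (S E)"
      proof
        fix x assume x: "x \<in> S E"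
        then obtain i w where "i \<in> indices N" "w \<in> C i" "x \<in> fibre (E i) w"
          by (auto simp: S_def)
        then have "x \<in> eigenspace T w"
          using sub unfolding holomorphic_subbundle_def by (auto simp: fibre_def kernel_bundle_def)
        then have "T x = w *\<^sub>C x"
          by (simp add: eigenspace_def)
        then show "x \<in> T -` closed_cspan (S E)"
          using M(3)[of E] x complex_vector.subspace_scale[OF csubspace_closed_cspan]
          by (auto simp: M_def)
      qed
      show "csubspace (T -` closed_cspan (S E))"
        using T csubspace_closed_cspan[of "S E"]
        by (auto simp: complex_vector.subspace_def bounded_clinear_def T.add T.zero)
      show "closed (T -` closed_cspan (S E))"
        by (intro closed_vimage closed_closed_cspan linear_continuous_on T.bounded_linear_axioms)
    qed
    then show ?thesis
      by blast
  qed
  \<comment> \<open>A zero closed span makes every fibre zero. Since \<open>E i\<close> has no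
    points outside \<open>C i\<close>, it is then exactly the zero bundle.\<close>
  have nontriv: "M E \<noteq> {0}" if "Sigma (indices N) E \<noteq> (SIGMA i : indices N. C i \<times> {0})"
    and zero: "\<And>i w. i \<in> indices N \<Longrightarrow> w \<in> C i \<Longrightarrow> 0 \<in> fibre (E i) w"
    and sub: "\<forall>i\<in>indices N. holomorphic_subbundle (C i) (E i) (kernel_bundle T (C i))" for E
  proof
    assume "M E = {0}"
    then have "fibre (E i) w \<subseteq> {0}" if "i \<in> indices N" "w \<in> C i" for i w
      using M(3)[of E] that by (auto simp: S_def)
    moreover have "E i \<subseteq> C i \<times> UNIV" if "i \<in> indices N" for i
      using sub that by (simp add: holomorphic_subbundle_def)
    ultimately have "E i = C i \<times> {0}" if "i \<in> indices N" for i
      using zero that by (fastforce simp: fibre_def)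
    then show False
      using \<open>Sigma (indices N) E \<noteq> _\<close> by (simp add: Sigma_eq_iff)
  qed
  have "0 \<in> fibre (E1 i) w \<inter> fibre (E2 i) w" if "i \<in> indices N" "w \<in> C i" for i w
    using sum that by simp
  then have "M E1 \<noteq> {0}" "M E2 \<noteq> {0}"
    by (auto intro!: nontriv[OF nz(1) _ sub(1)] nontriv[OF nz(2) _ sub(2)])
  \<comment> \<open>Properness of \<open>M E1\<close> is nontriviality of its complement
    \<open>M E2\<close>.\<close>
  moreover have "M E2 = {0}" if "M E1 = UNIV"
    using orthocomplement_Int[OF M(1), of E1] perp that by simp
  ultimately have "reducing_subspace T (M E1) \<and> M E1 \<noteq> {0} \<and> M E1 \<noteq> UNIV"
    using M inv[of E1, OF sub(1)] inv[of E2, OF sub(2)] by (auto simp: reducing_subspace_def perp)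
  then show ?thesis
    using reducible_operator_iff[OF T] by blast
qed

theorem theorem4p7:
  fixes \<Omega> :: "complex set"
    and N :: enat
    and C :: "nat \<Rightarrow> complex set"
    and \<alpha> :: "nat \<Rightarrow> nat"
    and T :: "'h::complex_hilbert_space \<Rightarrow> 'h"
  assumes "bounded \<Omega>" and "open \<Omega>"
    and "1 \<le> N"
    and "bij_betw C (indices N) (components \<Omega>)"
    and "\<forall>i\<in>indices N. 0 < \<alpha> i"
    and "separable_space (euclidean :: 'h topology)"
    and "T \<in> generalized_Cowen_Douglas \<Omega> N C \<alpha>"
  shows "reducible_operator T \<longleftrightarrow> reducible_kernel_bundle T N C"
proof -
  have C: "C ` indices N = components \<Omega>"
    using assms(4) by (rule bij_betw_imp_surj_on)
  have comp: "C i \<in> components \<Omega>" if "i \<in> indices N" for i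
    using that by (simp flip: C)
  \<comment> \<open>Surjectivity and totality are given over \<open>\<Omega>\<close>, the bundles
    over its components; this identity translates between them.\<close>
  have \<Omega>: "\<Omega> = (\<Union>i\<in>indices N. C i)"
    using Union_components[of \<Omega>] by (simp add: C)
  have T: "bounded_clinear T"
    and surj: "\<And>w. w \<in> \<Omega> \<Longrightarrow> range (\<lambda>x. T x - w *\<^sub>C x) = UNIV"
    and "closed_cspan (\<Union>w\<in>\<Omega>. eigenspace T w) = UNIV"
    and dim: "\<And>i w. i \<in> indices N \<Longrightarrow> w \<in> C i \<Longrightarrow> cdim (eigenspace T w) = \<alpha> i"
    using assms(7) by (simp_all add: generalized_Cowen_Douglas_def)
  then have total: "closed_cspan (\<Union>i\<in>indices N. \<Union>w\<in>C i. eigenspace T w) = UNIV"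
    by (simp add: \<Omega> UN_UN_flatten)
  show ?thesis
  proof
    assume "reducible_operator T"
    then show "reducible_kernel_bundle T N C"
    proof (rule reducible_kernel_bundle_if_reducible_operator[OF T _ _ _ _ dim _ total])
      show "open (C i)" "connected (C i)" if "i \<in> indices N" for i
        using open_components[OF assms(2) comp[OF that]] in_components_connected[OF comp[OF that]] .
      show "range (\<lambda>x. T x - w *\<^sub>C x) = UNIV" if "i \<in> indices N" "w \<in> C i" for i w
        using surj[of w] that by (auto simp: \<Omega>)
    qed (use assms(5) in auto)
  next
    assume "reducible_kernel_bundle T N C"
    then show "reducible_operator T"
      by (rule reducible_operator_if_reducible_kernel_bundle[OF T _ total])
  qed
qed

end
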